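(* Let $\widehat G$ be a signed ribbon graph corresponding to a checkerboard colorable virtual link diagram $L$ endowed with an orientation. Then $$J_L(t) \;=\; (-1)^{w(L)}\, t^{\frac{3w(L)-r(\widehat G)+n(\widehat G)}{4}}\, \bigl(-t^{1/2}-t^{-1/2}\bigr)^{k(\widehat G)-1}\, R_{\widehat G}\Bigl(-t-1,\ -t^{-1}-1,\ \frac{1}{-t^{1/2}-t^{-1/2}}\Bigr),$$ where $J_L$ is the Jones polynomial of $L$, $w(L)$ its writhe and $R_{\widehat G}$ the signed Bollobás–Riordan polynomial. In particular, if $\widehat G$ is a planar ribbon graph with only positive edges and $\Gamma$ is its core graph, then $$J_L(t) \;=\; (-1)^{w(L)}\, t^{\frac{3w(L)-r(\widehat G)+n(\widehat G)}{4}}\, \bigl(-t^{1/2}-t^{-1/2}\bigr)^{k(\widehat G)-1}\, T_{\Gamma}(-t,-t^{-1}),$$ where $T_\Gamma$ is the Tutte polynomial of $\Gamma$.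
   Context: **Virtual link diagrams.** A virtual link diagram is a generic immersion of finitely many circles in the plane, each double point of which is marked either as a classical crossing (with over/under information) or as a virtual crossing (no further information). It is alternating if, along every component, classical overcrossings and undercrossings alternate (virtual crossings are ignored). **Kauffman bracket and Jones polynomial.** At a classical crossing, the $A$-splitting is the smoothing that unites the two regions (angles) swept out by the overcrossing arc when rotated counterclockwise until it meets the undercrossing arc; the $B$-splitting is the smoothing that unites the other two angles. A state $S$ of $L$ is a choice of $A$- or $B$-splitting at each classical crossing; $\mathcal S(L)$ is the set of states. Let $\alpha(S)$, $\beta(S)$ be the numbers of $A$- and $B$-splittings in $S$, and $\delta(S)$ the number of components (closed curves) obtained from $L$ by performing all the splittings of $S$; virtual crossings are not touched and do not connect components. Then $$[L](A,B,d)=\sum_{S\in\mathcal S(L)}A^{\alpha(S)}B^{\beta(S)}d^{\,\delta(S)-1}.$$ For oriented $L$, the writhe $w(L)$ is the sum over the classical crossings of the usual crossing signs ($+1$ if the direction of the overstrand followed by that of the understrand is a positively oriented basis of the plane, $-1$ otherwise), and $$J_L(t):=(-1)^{w(L)}t^{3w(L)/4}\,[L]\bigl(t^{-1/4},\,t^{1/4},\,-t^{1/2}-t^{-1/2}\bigr).$$ **Ribbon graphs.** A ribbon graph $G$ is a finite undirected graph $(V,E)$ (loops and multiple edges allowed), called its core graph, with a cyclic order, at each vertex, on the edge-ends incident to it (loops counted twice). Equivalently, it is an oriented surface with boundary that is the union of closed discs ("vertices") and closed discs ("edges", i.e. ribbons), such that vertices and edges intersect in disjoint line segments, each such segment lies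 on the boundary of exactly one vertex and exactly one edge, and each edge contains exactly two such segments. Ribbon graphs are regarded as abstract surfaces (no embedding in 3-space). $G$ is planar if this surface has genus zero. Let $v(G)=|V|$, $e(G)=|E|$, $k(G)$ = number of connected components, $r(G)=v(G)-k(G)$, $n(G)=e(G)-r(G)$, and $\mathrm{bc}(G)$ = number of connected components of the boundary of the surface $G$. A spanning subgraph contains all the vertices and a subset of the edges (with the induced ribbon structure); $\mathcal F(G)$ is the set of all spanning subgraphs. The Tutte polynomial of a graph $\Gamma$ is $T_\Gamma(x,y)=\sum_F (x-1)^{r(\Gamma)-r(F)}(y-1)^{n(F)}$, the sum being over all spanning subgraphs $F$ of $\Gamma$. **Signed ribbon graphs.** A signed ribbon graph $\widehat G$ is a ribbon graph $G$ with a sign function $\varepsilon:E\to\{\pm1\}$; its parameters $v,e,k,r,n,\mathrm{bc}$ are those of $G$. For a spanning subgraph $F$, let $e_-(F)$ be the number of edges of $F$ with sign $-1$, let $\overline F=\widehat G-F$ be the spanning subgraph whose edges are exactly those not in $F$, and let $s(F)=\frac{e_-(F)-e_-(\overline F)}{2}$. The signed Bollobás–Riordan polynomial is $$R_{\widehat G}(x,y,z)=\sum_{F\in\mathcal F(\widehat G)}x^{r(\widehat G)-r(F)+s(F)}\,y^{n(F)-s(F)}\,z^{k(F)-\mathrm{bc}(F)+n(F)},$$ a Laurent polynomial in $x^{1/2},y^{1/2},z$. Since $2s(F)\in\mathbb Z$ and half-integer powers occur only through $x^{s(F)}y^{-s(F)}=(x^{1/2}/y^{1/2})^{2s(F)}$,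 evaluating it requires only a choice of $x^{1/2}/y^{1/2}$, a square root of $x/y$; at $x=-t-1$, $y=-t^{-1}-1$ (where $x/y=t$) the choice is $x^{1/2}/y^{1/2}=t^{1/2}$. Throughout, a fixed root $t^{1/4}$ is used for all fractional powers of $t$. **Checkerboard coloring.** A checkerboard coloring of a virtual link diagram is a coloring (black) of one side of the diagram in a small neighborhood of it, such that near a classical crossing the coloring alternates as on a checkerboard (two opposite angles black), and near a virtual crossing the colorings of the two strands pass through without noticing each other. A diagram is checkerboard colorable if it has such a coloring. It is a known fact (N. Kamada) that a virtual link diagram is checkerboard colorable if and only if it can be made alternating by switching over/under at some set of classical crossings. An alternating diagram has a canonical checkerboard coloring: near each classical crossing, the black angles are the two vertical angles swept out by the overcrossing arc under counterclockwise rotation, i.e. those united by the $A$-splitting; since the diagram is alternating, these local colorings agree along arcs and extend to a global checkerboard coloring. **The ribbon graph $G_{\widetilde L}$ of an alternating diagram $\widetilde L$.** The canonical coloring of $\widetilde L$ is a collection of annuli (immersed in the plane, overlapping only at virtual crossings). Each annulus has an exterior circle, which runs along the link except near classical crossings, where it jumps from one strand to the other, staying within the black angle (so the exterior circles are exactly the closed curves of the state of $\widetilde L$ with all $B$-splittings), and an interior circle. The surface $G_{\widetilde L}$ is obtained by replacing each classical crossing by an edge-ribbon, untwisted with respect to the plane, connecting the two arcs of exterior circles in the two opposite black angles at that crossing (so that the two free sides of the ribbon are the two arcs of the $A$-splitting of $\widetilde L$ there), and by gluing discs along all the interior circles. The vertices of $G_{\widetilde L}$ are the annuli capped off by these discs,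 the edges are the ribbons, in bijection with the classical crossings of $\widetilde L$; the orientation is induced from that of the plane on the annuli and ribbons. A component without classical crossings contributes an isolated vertex. **Signed ribbon graph corresponding to $L$.** Given a checkerboard colorable diagram $L$, choose a set of classical crossings whose switching turns $L$ into an alternating diagram $\widetilde L$. The corresponding signed ribbon graph is $G_{\widetilde L}$ with sign $-1$ on the edges corresponding to the switched crossings and $+1$ on the other edges. It depends on the choice of the switched set; any choice is allowed. *)

theory Defs
  imports "HOL-Analysis.Analysis" "HOL-Combinatorics.Orbits"
begin

section \<open>Graphs and ribbon graphs\<close>

text \<open>
  A finite undirected graph, loops and multiple edges allowed, is given by its vertices, its edges
  and its edge-ends: every edge has exactly two ends, and every end is attached to one vertex.
  A loop has both its ends attached to the same vertex.
\<close>

record ('v, 'e, 'h) multigraph =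
  verts :: "'v set"
  edges :: "'e set"
  ends :: "'h set"
  end_vert :: "'h \<Rightarrow> 'v"
  end_edge :: "'h \<Rightarrow> 'e"

definition multigraph :: "('v, 'e, 'h, 'm) multigraph_scheme \<Rightarrow> bool" where
  "multigraph G \<longleftrightarrow>
     finite (verts G) \<and> finite (edges G) \<and> finite (ends G) \<and>
     end_vert G ` ends G \<subseteq> verts G \<and> end_edge G ` ends G \<subseteq> edges G \<and>
     (\<forall>e\<in>edges G. card {h \<in> ends G. end_edge G h = e} = 2)"

definition connected_rel :: "('v, 'e, 'h, 'm) multigraph_scheme \<Rightarrow> ('v \<times> 'v) set" where
  "connected_rel G =
     {(end_vert G h, end_vert G h') | h h'. h \<in> ends G \<and> h' \<in> ends G \<and> end_edge G h = end_edge G h'}\<^sup>*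
       \<inter> verts G \<times> verts G"

definition num_verts :: "('v, 'e, 'h, 'm) multigraph_scheme \<Rightarrow> int" where
  "num_verts G = int (card (verts G))"

definition num_edges :: "('v, 'e, 'h, 'm) multigraph_scheme \<Rightarrow> int" where
  "num_edges G = int (card (edges G))"

definition num_comps :: "('v, 'e, 'h, 'm) multigraph_scheme \<Rightarrow> int" where
  "num_comps G = int (card (verts G // connected_rel G))"

definition graph_rank :: "('v, 'e, 'h, 'm) multigraph_scheme \<Rightarrow> int" where
  "graph_rank G = num_verts G - num_comps G"

definition graph_nullity :: "('v, 'e, 'h, 'm) multigraph_scheme \<Rightarrow> int" where
  "graph_nullity G = num_edges G - graph_rank G"

definition spanning_subgraph ::
    "('v, 'e, 'h, 'm) multigraph_scheme \<Rightarrow> 'e set \<Rightarrow> ('v, 'e, 'h, 'm) multigraph_scheme" where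
  "spanning_subgraph G F = G\<lparr>edges := F, ends := {h \<in> ends G. end_edge G h \<in> F}\<rparr>"

definition tutte_poly :: "('v, 'e, 'h, 'm) multigraph_scheme \<Rightarrow> 'a::field \<Rightarrow> 'a \<Rightarrow> 'a" where
  "tutte_poly G x y =
     (\<Sum>F\<in>Pow (edges G).
        (x - 1) powi (graph_rank G - graph_rank (spanning_subgraph G F)) *
        (y - 1) powi graph_nullity (spanning_subgraph G F))"

text \<open>
  A ribbon graph additionally carries a permutation of its edge-ends whose cycles are the cyclic
  orders at the vertices; \<open>rot G h\<close> is the end following \<open>h\<close> counterclockwise
  around the vertex disc of \<open>h\<close>.
\<close>

record ('v, 'e, 'h) ribbon_graph = "('v, 'e, 'h) multigraph" +
  rot :: "'h \<Rightarrow> 'h"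

definition ribbon_graph :: "('v, 'e, 'h, 'm) ribbon_graph_scheme \<Rightarrow> bool" where
  "ribbon_graph G \<longleftrightarrow>
     multigraph G \<and> bij_betw (rot G) (ends G) (ends G) \<and>
     (\<forall>h\<in>ends G. cyclic_on (rot G) {h' \<in> ends G. end_vert G h' = end_vert G h})"

definition core_graph :: "('v, 'e, 'h, 'm) ribbon_graph_scheme \<Rightarrow> ('v, 'e, 'h) multigraph" where
  "core_graph G = multigraph.truncate G"

text \<open>In a spanning ribbon subgraph, the end following \<open>h\<close> is the first remaining one after \<open>h\<close>.\<close>

definition spanning_ribbon_subgraph ::
    "('v, 'e, 'h, 'm) ribbon_graph_scheme \<Rightarrow> 'e set \<Rightarrow> ('v, 'e, 'h, 'm) ribbon_graph_scheme" where
  "spanning_ribbon_subgraph G F =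
     (spanning_subgraph G F)
       \<lparr>rot := (\<lambda>h. (rot G ^^ (LEAST n. 0 < n \<and> end_edge G ((rot G ^^ n) h) \<in> F)) h)\<rparr>"

definition opposite_end :: "('v, 'e, 'h, 'm) multigraph_scheme \<Rightarrow> 'h \<Rightarrow> 'h" where
  "opposite_end G h = (THE h'. h' \<in> ends G \<and> h' \<noteq> h \<and> end_edge G h' = end_edge G h)"

text \<open>
  Walk along the boundary of the surface, keeping it on the left. Running along a side of a ribbon
  away from its end \<open>h\<close>, one arrives at the vertex of the opposite end, follows the
  boundary of this vertex disc counterclockwise to the next end, and runs along the ribbon attached
  there. Hence the boundary components that meet a ribbon are the cycles of
  \<open>rot G \<circ> opposite_end G\<close>. Each remaining one is the boundary of an isolated vertex.
\<close>

definition num_bdry :: "('v, 'e, 'h, 'm) ribbon_graph_scheme \<Rightarrow> int" where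
  "num_bdry G =
     int (card (orbit (rot G \<circ> opposite_end G) ` ends G)) +
     int (card (verts G - end_vert G ` ends G))"

text \<open>
  Capping off the boundary with discs yields a closed oriented surface of Euler characteristic
  \<open>v - e + bc = 2 k - 2 g\<close>, where \<open>g\<close> is the sum of the genera of its components.
\<close>

definition genus :: "('v, 'e, 'h, 'm) ribbon_graph_scheme \<Rightarrow> real" where
  "genus G = of_int (2 * num_comps G - (num_verts G - num_edges G + num_bdry G)) / 2"

definition planar :: "('v, 'e, 'h, 'm) ribbon_graph_scheme \<Rightarrow> bool" where
  "planar G \<longleftrightarrow> genus G = 0"


section \<open>The signed Bollobas--Riordan polynomial\<close>

record ('v, 'e, 'h) signed_ribbon_graph = "('v, 'e, 'h) ribbon_graph" +
  edge_sign :: "'e \<Rightarrow> int"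

definition signed_ribbon_graph :: "('v, 'e, 'h, 'm) signed_ribbon_graph_scheme \<Rightarrow> bool" where
  "signed_ribbon_graph G \<longleftrightarrow> ribbon_graph G \<and> edge_sign G ` edges G \<subseteq> {1, -1}"

definition num_neg :: "('v, 'e, 'h, 'm) signed_ribbon_graph_scheme \<Rightarrow> int" where
  "num_neg G = int (card {e \<in> edges G. edge_sign G e = -1})"

definition twice_s :: "('v, 'e, 'h, 'm) signed_ribbon_graph_scheme \<Rightarrow> 'e set \<Rightarrow> int" where
  "twice_s G F =
     num_neg (spanning_ribbon_subgraph G F) - num_neg (spanning_ribbon_subgraph G (edges G - F))"

text \<open>
  The number \<open>s(F)\<close> is half of \<open>twice_s G F\<close>. Half-integer powers occur
  only through \<open>x\<^sup>s y\<^sup>-\<^sup>s = q\<^sup>2\<^sup>s\<close>, where \<open>q\<close> is the chosen square root of \<open>x / y\<close>; so \<open>q\<close>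
  is passed as an additional argument, which has to satisfy \<open>q\<^sup>2 y = x\<close>.
\<close>

definition BR_poly ::
    "('v, 'e, 'h, 'm) signed_ribbon_graph_scheme \<Rightarrow> 'a::field \<Rightarrow> 'a \<Rightarrow> 'a \<Rightarrow> 'a \<Rightarrow> 'a" where
  "BR_poly G q x y z =
     (\<Sum>F\<in>Pow (edges G).
        let H = spanning_ribbon_subgraph G F in
          x powi (graph_rank G - graph_rank H) * y powi graph_nullity H * q powi twice_s G F *
          z powi (num_comps H - num_bdry H + graph_nullity H))"


section \<open>Oriented virtual link diagrams\<close>

text \<open>
  The circles are copies of \<open>\<real> / \<int>\<close>, indexed by \<open>comps D\<close> and immersed in the
  plane \<open>\<complex>\<close> by \<open>curve D\<close>; the direction of the parametrization is the orientation of
  the diagram. A passage \<open>(i, s)\<close> is the point with parameter \<open>s \<in> [0, 1)\<close> on the circle \<open>i\<close>.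
  Crossings are points of the plane. The double points outside \<open>classical D\<close> are the
  virtual crossings, and \<open>over D\<close> consists of the overpassages through classical crossings.
\<close>

type_synonym 'i passage = "'i \<times> real"

record 'i diagram =
  comps :: "'i set"
  curve :: "'i \<Rightarrow> real \<Rightarrow> complex"
  classical :: "complex set"
  over :: "'i passage set"

definition pos :: "'i diagram \<Rightarrow> 'i passage \<Rightarrow> complex" where
  "pos D p = curve D (fst p) (snd p)"

definition velocity :: "'i diagram \<Rightarrow> 'i passage \<Rightarrow> complex" where
  "velocity D p = vector_derivative (curve D (fst p)) (at (snd p))"

definition preimages :: "'i diagram \<Rightarrow> complex \<Rightarrow> 'i passage set" where
  "preimages D z = {p \<in> comps D \<times> {0..<1}. pos D p = z}"

definition double_points :: "'i diagram \<Rightarrow> complex set" where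
  "double_points D = {z. \<exists>p\<in>preimages D z. \<exists>q\<in>preimages D z. p \<noteq> q}"

text \<open>The determinant of \<open>(u, v)\<close>; it is positive iff \<open>(u, v)\<close> is a positively oriented basis.\<close>

definition det2 :: "complex \<Rightarrow> complex \<Rightarrow> real" where
  "det2 u v = Re u * Im v - Im u * Re v"

definition virtual_link_diagram :: "'i diagram \<Rightarrow> bool" where
  "virtual_link_diagram D \<longleftrightarrow>
     finite (comps D) \<and>
     (\<forall>i\<in>comps D.
        (\<forall>s. curve D i (s + 1) = curve D i s) \<and>
        curve D i C1_differentiable_on UNIV \<and>
        (\<forall>s. vector_derivative (curve D i) (at s) \<noteq> 0)) \<and>
     finite (double_points D) \<and>
     (\<forall>z\<in>double_points D. card (preimages D z) = 2) \<and>
     (\<forall>z\<in>double_points D. \<forall>p\<in>preimages D z. \<forall>q\<in>preimages D z.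
        p \<noteq> q \<longrightarrow> det2 (velocity D p) (velocity D q) \<noteq> 0) \<and>
     classical D \<subseteq> double_points D \<and>
     over D \<subseteq> (\<Union>z\<in>classical D. preimages D z) \<and>
     (\<forall>z\<in>classical D. \<exists>!p. p \<in> preimages D z \<and> p \<in> over D)"

definition passages :: "'i diagram \<Rightarrow> 'i passage set" where
  "passages D = (\<Union>z\<in>classical D. preimages D z)"

definition partner :: "'i diagram \<Rightarrow> 'i passage \<Rightarrow> 'i passage" where
  "partner D p = (THE q. q \<in> preimages D (pos D p) \<and> q \<noteq> p)"

definition switch :: "complex set \<Rightarrow> 'i diagram \<Rightarrow> 'i diagram" where
  "switch W D = D\<lparr>over := {p \<in> passages D. if pos D p \<in> W then p \<notin> over D else p \<in> over D}\<rparr>"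

text \<open>
  The next, or previous, classical passage along a component. Virtual crossings are ignored. If the
  component has only one classical passage, that passage is its own successor.
\<close>

definition next_passage :: "'i diagram \<Rightarrow> 'i passage \<Rightarrow> 'i passage" where
  "next_passage D p =
     (let T = {t. (fst p, t) \<in> passages D} in
        (fst p, if \<exists>t\<in>T. snd p < t then Min {t \<in> T. snd p < t} else Min T))"

definition prev_passage :: "'i diagram \<Rightarrow> 'i passage \<Rightarrow> 'i passage" where
  "prev_passage D p =
     (let T = {t. (fst p, t) \<in> passages D} in
        (fst p, if \<exists>t\<in>T. t < snd p then Max {t \<in> T. t < snd p} else Max T))"

definition alternating :: "'i diagram \<Rightarrow> bool" where
  "alternating D \<longleftrightarrow> (\<forall>p\<in>passages D. next_passage D p \<in> over D \<longleftrightarrow> p \<notin> over D)"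


section \<open>Strand ends, smoothings and checkerboard colorings\<close>

text \<open>
  Four strand ends emanate from every classical crossing: \<open>(p, True)\<close> is the piece of the
  strand just after the passage \<open>p\<close> and \<open>(p, False)\<close> the piece just before it.
  Each is viewed as pointing away from the crossing.
\<close>

type_synonym 'i strand_end = "'i passage \<times> bool"

definition strand_ends :: "'i diagram \<Rightarrow> 'i strand_end set" where
  "strand_ends D = passages D \<times> UNIV"

definition direction :: "'i diagram \<Rightarrow> 'i strand_end \<Rightarrow> complex" where
  "direction D x = (if snd x then velocity D (fst x) else - velocity D (fst x))"

text \<open>The end next to a given one in counterclockwise, or clockwise, order around the crossing.\<close>

definition ccw :: "'i diagram \<Rightarrow> 'i strand_end \<Rightarrow> 'i strand_end" where
  "ccw D x = (let q = partner D (fst x) in (q, det2 (direction D x) (velocity D q) > 0))"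

definition cw :: "'i diagram \<Rightarrow> 'i strand_end \<Rightarrow> 'i strand_end" where
  "cw D x = (let q = partner D (fst x) in (q, det2 (direction D x) (velocity D q) < 0))"

text \<open>The other end of the arc, free of classical crossings, that starts at the given end.\<close>

definition arc_end :: "'i diagram \<Rightarrow> 'i strand_end \<Rightarrow> 'i strand_end" where
  "arc_end D x =
     (if snd x then (next_passage D (fst x), False) else (prev_passage D (fst x), True))"

text \<open>
  The angle from an end \<open>x\<close> to \<open>ccw D x\<close> is swept out by the overcrossing arc rotating
  counterclockwise iff \<open>x\<close> lies on the overcrossing arc. The \<open>A\<close>-splitting unites these two
  angles, so its arcs join the ends bounding each of the other two angles; the
  \<open>B\<close>-splitting does the opposite.
\<close>

definition A_smoothing :: "'i diagram \<Rightarrow> 'i strand_end \<Rightarrow> 'i strand_end" where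
  "A_smoothing D x = (if fst x \<in> over D then cw D x else ccw D x)"

definition B_smoothing :: "'i diagram \<Rightarrow> 'i strand_end \<Rightarrow> 'i strand_end" where
  "B_smoothing D x = (if fst x \<in> over D then ccw D x else cw D x)"

text \<open>
  A state is identified with the set \<open>S\<close> of classical crossings at which it has an
  \<open>A\<close>-splitting. Its closed curves are the classes of strand ends joined by arcs and
  smoothings, together with the components that have no classical crossing.
\<close>

definition state_rel :: "'i diagram \<Rightarrow> complex set \<Rightarrow> ('i strand_end \<times> 'i strand_end) set" where
  "state_rel D S =
     ({(x, arc_end D x) | x. x \<in> strand_ends D} \<union>
      {(x, if pos D (fst x) \<in> S then A_smoothing D x else B_smoothing D x) | x. x \<in> strand_ends D})\<^sup>*
       \<inter> strand_ends D \<times> strand_ends D"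

definition state_curves :: "'i diagram \<Rightarrow> complex set \<Rightarrow> ('i strand_end set + 'i) set" where
  "state_curves D S =
     (strand_ends D // state_rel D S) <+> {i \<in> comps D. \<forall>s. (i, s) \<notin> passages D}"

text \<open>
  In a checkerboard coloring, \<open>c x\<close> says that the black side is the left one when moving away
  from the crossing along \<open>x\<close>. Seen from the other end of the arc, left and right are exchanged.
  The angle between \<open>x\<close> and \<open>ccw D x\<close> is to the left of \<open>x\<close> and to the right of
  \<open>ccw D x\<close>, so the second condition says that the color of an angle is
  well-defined and differs from that of the adjacent angles. A component without classical
  crossings may be colored on either side, so it imposes no condition.
\<close>

definition checkerboard_coloring :: "'i diagram \<Rightarrow> ('i strand_end \<Rightarrow> bool) \<Rightarrow> bool" where
  "checkerboard_coloring D c \<longleftrightarrow>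
     (\<forall>x\<in>strand_ends D. (c (arc_end D x) \<longleftrightarrow> \<not> c x) \<and> (c (ccw D x) \<longleftrightarrow> \<not> c x))"

definition checkerboard_colorable :: "'i diagram \<Rightarrow> bool" where
  "checkerboard_colorable D \<longleftrightarrow> (\<exists>c. checkerboard_coloring D c)"


section \<open>The Kauffman bracket and the Jones polynomial\<close>

definition kauffman_bracket :: "'i diagram \<Rightarrow> 'a::field \<Rightarrow> 'a \<Rightarrow> 'a \<Rightarrow> 'a" where
  "kauffman_bracket D A B d =
     (\<Sum>S\<in>Pow (classical D).
        A ^ card S * B ^ card (classical D - S) * d powi (int (card (state_curves D S)) - 1))"

definition writhe :: "'i diagram \<Rightarrow> int" where
  "writhe D =
     (\<Sum>p\<in>over D. if det2 (velocity D p) (velocity D (partner D p)) > 0 then 1 else -1)"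

text \<open>The argument \<open>a\<close> is the chosen fourth root of \<open>t\<close>.\<close>

definition jones :: "'i diagram \<Rightarrow> 'a::field \<Rightarrow> 'a" where
  "jones D a =
     (-1) powi writhe D * a powi (3 * writhe D) *
     kauffman_bracket D (inverse a) a (- (a^2) - inverse (a^2))"


section \<open>The ribbon graph of an alternating diagram\<close>

text \<open>
  The vertices are the annuli of the canonical coloring; each is represented by its
  exterior circle, which is a closed curve of the all-\<open>B\<close> state. The black angles are those from
  \<open>x\<close> to \<open>ccw D x\<close> with \<open>x\<close> on the overcrossing arc; each is represented by \<open>x\<close>, and it is there
  that an end of the ribbon of the crossing is attached to the annulus. Moving along \<open>x\<close> away from
  the crossing one has the annulus on the left, so this is the counterclockwise direction around
  the vertex disc. The arc arrives at its other end \<open>arc_end D x\<close>, whose black angle starts at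
  \<open>cw D (arc_end D x)\<close>. Components without classical crossings give isolated vertices.
\<close>

type_synonym 'i link_ribbon_graph =
  "('i strand_end set + 'i, complex, 'i strand_end) signed_ribbon_graph"

definition alternating_ribbon_graph :: "'i diagram \<Rightarrow> (complex \<Rightarrow> int) \<Rightarrow> 'i link_ribbon_graph" where
  "alternating_ribbon_graph D eps =
     \<lparr>verts = state_curves D {},
      edges = classical D,
      ends = {x \<in> strand_ends D. fst x \<in> over D},
      end_vert = (\<lambda>x. Inl (state_rel D {} `` {x})),
      end_edge = (\<lambda>x. pos D (fst x)),
      rot = (\<lambda>x. cw D (arc_end D x)),
      edge_sign = eps\<rparr>"

text \<open>The switched set is arbitrary, so a diagram may have several corresponding graphs.\<close>

definition corresponding_ribbon_graph :: "'i diagram \<Rightarrow> 'i link_ribbon_graph \<Rightarrow> bool" where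
  "corresponding_ribbon_graph D G \<longleftrightarrow>
     (\<exists>W\<subseteq>classical D. alternating (switch W D) \<and>
        G = alternating_ribbon_graph (switch W D) (\<lambda>z. if z \<in> W then -1 else 1))"


text \<open>The construction does yield a signed ribbon graph.\<close>

context
  fixes D :: "'i diagram"
  assumes D: "virtual_link_diagram D"
begin

private lemma diagram_facts:
  "finite (comps D)" "finite (double_points D)"
  "\<forall>z\<in>double_points D. card (preimages D z) = 2"
  "\<forall>z\<in>double_points D. \<forall>p\<in>preimages D z. \<forall>q\<in>preimages D z.
     p \<noteq> q \<longrightarrow> det2 (velocity D p) (velocity D q) \<noteq> 0"
  "classical D \<subseteq> double_points D"
  "\<forall>z\<in>classical D. \<exists>!p. p \<in> preimages D z \<and> p \<in> over D"
  using D unfolding virtual_link_diagram_def by - (elim conjE, assumption)+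

private lemma finite_passages: "finite (passages D)"
proof -
  have "finite (preimages D z)" if "z \<in> classical D" for z
    using diagram_facts(3,5) that by (metis card.infinite subsetD zero_neq_numeral)
  moreover have "finite (classical D)"
    using diagram_facts(2,5) by (rule finite_subset[rotated])
  ultimately show ?thesis unfolding passages_def by blast
qed

private lemma passage_facts:
  assumes "p \<in> passages D"
  shows "pos D p \<in> classical D" "partner D p \<in> passages D" "partner D p \<noteq> p"
    "partner D (partner D p) = p" "pos D (partner D p) = pos D p"
    "partner D p \<in> over D \<longleftrightarrow> p \<notin> over D"
    "det2 (velocity D p) (velocity D (partner D p)) \<noteq> 0"
    "preimages D (pos D p) = {p, partner D p}"
proof -
  obtain z where z: "z \<in> classical D" "p \<in> preimages D z" using assms passages_def by blast
  have zp: "z = pos D p" using z(2) by (simp add: preimages_def)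
  show c: "pos D p \<in> classical D" using z zp by simp
  have dp: "pos D p \<in> double_points D" using c diagram_facts(5) by blast
  have "card (preimages D (pos D p)) = 2" using dp diagram_facts(3) by blast
  then obtain u v where "preimages D (pos D p) = {u, v}" "u \<noteq> v" by (auto simp only: card_2_iff)
  moreover have "p \<in> preimages D (pos D p)" using z(2) zp by simp
  ultimately obtain q where q: "preimages D (pos D p) = {p, q}" "q \<noteq> p"
    by (metis insertE insert_commute singletonD)
  have pq: "partner D p = q" unfolding partner_def using q by (intro the_equality) auto
  have posq: "pos D q = pos D p" using q(1) unfolding preimages_def by blast
  show "partner D p \<in> passages D" using q(1) c pq unfolding passages_def by blast
  show "partner D p \<noteq> p" "pos D (partner D p) = pos D p"
    "preimages D (pos D p) = {p, partner D p}" using pq posq q by auto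
  show "partner D (partner D p) = p"
    unfolding pq unfolding partner_def posq using q by (intro the_equality) auto
  have "\<exists>!p'. p' \<in> preimages D (pos D p) \<and> p' \<in> over D"
    using c diagram_facts(6) by blast
  then show "partner D p \<in> over D \<longleftrightarrow> p \<notin> over D" unfolding pq q(1) using q(2) by blast
  have "p \<in> preimages D (pos D p)" "q \<in> preimages D (pos D p)" using q(1) by auto
  then show "det2 (velocity D p) (velocity D (partner D p)) \<noteq> 0"
    unfolding pq using q(2) dp diagram_facts(4) by metis
qed

private lemma next_prev:
  assumes "p \<in> passages D"
  shows "next_passage D p \<in> passages D" "prev_passage D p \<in> passages D"
    "prev_passage D (next_passage D p) = p" "next_passage D (prev_passage D p) = p"
proof -
  obtain i s where p: "p = (i, s)" by force
  define T where "T = {t. (i, t) \<in> passages D}"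
  have "finite T"
    unfolding T_def by (rule finite_subset[OF _ finite_imageI[OF finite_passages, of snd]]) force
  note fin = this finite_subset[OF _ this]
  have sT: "s \<in> T" using assms p T_def by simp
  define N where "N t = (if \<exists>u\<in>T. t < u then Min {u \<in> T. t < u} else Min T)" for t
  define M where "M t = (if \<exists>u\<in>T. u < t then Max {u \<in> T. u < t} else Max T)" for t
  have nx: "next_passage D (i, t) = (i, N t)" for t
    unfolding next_passage_def N_def Let_def fst_conv snd_conv T_def[symmetric] ..
  have pv: "prev_passage D (i, t) = (i, M t)" for t
    unfolding prev_passage_def M_def Let_def fst_conv snd_conv T_def[symmetric] ..
  have N1: "N t \<in> T \<and> t < N t \<and> (\<forall>u\<in>T. t < u \<longrightarrow> N t \<le> u)" if "\<exists>u\<in>T. t < u" for t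
  proof -
    have "Min {u \<in> T. t < u} \<in> {u \<in> T. t < u}" by (rule Min_in) (use that fin in auto)
    then show ?thesis using that fin unfolding N_def by auto
  qed
  have N2: "N t \<in> T \<and> (\<forall>u\<in>T. N t \<le> u)" if "\<not> (\<exists>u\<in>T. t < u)" for t
    using that Min_in[OF \<open>finite T\<close>] Min_le[OF \<open>finite T\<close>] sT unfolding N_def by auto
  have M1: "M t \<in> T \<and> M t < t \<and> (\<forall>u\<in>T. u < t \<longrightarrow> u \<le> M t)" if "\<exists>u\<in>T. u < t" for t
  proof -
    have "Max {u \<in> T. u < t} \<in> {u \<in> T. u < t}" by (rule Max_in) (use that fin in auto)
    then show ?thesis using that fin unfolding M_def by auto
  qed
  have M2: "M t \<in> T \<and> (\<forall>u\<in>T. u \<le> M t)" if "\<not> (\<exists>u\<in>T. u < t)" for t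
    using that Max_in[OF \<open>finite T\<close>] Max_ge[OF \<open>finite T\<close>] sT unfolding M_def by auto
  have NT: "N s \<in> T" and MT: "M s \<in> T" using N1 N2 M1 M2 by blast+
  then show "next_passage D p \<in> passages D" "prev_passage D p \<in> passages D"
    using p nx pv T_def by auto
  have "M (N s) = s"
  proof (cases "\<exists>u\<in>T. s < u")
    case True
    with sT N1[OF True] M1[of "N s"] show ?thesis by (meson antisym_conv not_less)
  next
    case False
    with sT N2[OF False] M2[of "N s"] show ?thesis by (meson antisym_conv not_less)
  qed
  then show "prev_passage D (next_passage D p) = p" using p nx pv by simp
  have "N (M s) = s"
  proof (cases "\<exists>u\<in>T. u < s")
    case True
    with sT M1[OF True] N1[of "M s"] show ?thesis by (meson antisym_conv not_less)
  next
    case False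
    with sT M2[OF False] N2[of "M s"] show ?thesis by (meson antisym_conv not_less)
  qed
  then show "next_passage D (prev_passage D p) = p" using p nx pv by simp
qed

private lemma det2_simps: "det2 (- u) v = - det2 u v" "det2 v u = - det2 u v"
  by (auto simp: det2_def algebra_simps)

private lemma end_facts:
  assumes "x \<in> strand_ends D"
  shows "arc_end D x \<in> strand_ends D" "ccw D x \<in> strand_ends D" "cw D x \<in> strand_ends D"
    "arc_end D (arc_end D x) = x" "ccw D (cw D x) = x" "cw D (ccw D x) = x"
    "fst (ccw D x) \<in> over D \<longleftrightarrow> fst x \<notin> over D" "fst (cw D x) \<in> over D \<longleftrightarrow> fst x \<notin> over D"
proof -
  obtain p b where x: "x = (p, b)" by (cases x)
  have p: "p \<in> passages D" using assms x by (simp add: strand_ends_def)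
  note pf = passage_facts[OF p] and np = next_prev[OF p]
  show "arc_end D x \<in> strand_ends D" "arc_end D (arc_end D x) = x"
    using np by (auto simp: arc_end_def strand_ends_def x)
  show "ccw D x \<in> strand_ends D" "cw D x \<in> strand_ends D"
    "fst (ccw D x) \<in> over D \<longleftrightarrow> fst x \<notin> over D" "fst (cw D x) \<in> over D \<longleftrightarrow> fst x \<notin> over D"
    using pf by (auto simp: ccw_def cw_def strand_ends_def x Let_def)
  define e where "e = det2 (velocity D p) (velocity D (partner D p))"
  have e: "det2 (velocity D (partner D p)) (velocity D p) = - e" "e \<noteq> 0"
    "det2 (velocity D p) (velocity D (partner D p)) = e"
    using pf(7) det2_simps(2)[of "velocity D (partner D p)"] unfolding e_def by auto
  show "ccw D (cw D x) = x" "cw D (ccw D x) = x"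
    using e by (auto simp: ccw_def cw_def x Let_def direction_def pf det2_simps(1))
qed

private lemma equiv_state_rel: "equiv (strand_ends D) (state_rel D {})"
proof -
  let ?R = "{(x, arc_end D x) | x. x \<in> strand_ends D} \<union>
     {(x, if pos D (fst x) \<in> {} then A_smoothing D x else B_smoothing D x) | x. x \<in> strand_ends D}"
  have "B_smoothing D x \<in> strand_ends D \<and> B_smoothing D (B_smoothing D x) = x"
    if "x \<in> strand_ends D" for x
    using end_facts[OF that] by (auto simp: B_smoothing_def)
  then have "sym ?R" using end_facts by (auto simp: sym_def)
  then have "sym (?R\<^sup>*)" by (rule sym_rtrancl)
  then show ?thesis
    unfolding state_rel_def equiv_def refl_on_def sym_def trans_def by (blast intro: rtrancl_trans)
qed

lemma signed_ribbon_graph_alternating: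
  assumes alt: "alternating D" and eps: "eps ` classical D \<subseteq> {1, -1}"
  shows "signed_ribbon_graph (alternating_ribbon_graph D eps)"
proof -
  let ?G = "alternating_ribbon_graph D eps"
  define H where "H = {x \<in> strand_ends D. fst x \<in> over D}"
  define r where "r = (\<lambda>x. cw D (arc_end D x))"
  define cl where "cl x = state_rel D {} `` {x}" for x
  have finE: "finite (strand_ends D)" using finite_passages by (simp add: strand_ends_def)
  have finH: "finite H" using finE by (simp add: H_def)
  have arc_over: "fst (arc_end D x) \<in> over D \<longleftrightarrow> fst x \<notin> over D" if "x \<in> strand_ends D" for x
  proof -
    have p: "fst x \<in> passages D" using that by (auto simp: strand_ends_def)
    have "prev_passage D (fst x) \<in> over D \<longleftrightarrow> fst x \<notin> over D"
      using alt next_prev(2,4)[OF p] unfolding alternating_def by metis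
    moreover have "next_passage D (fst x) \<in> over D \<longleftrightarrow> fst x \<notin> over D"
      using alt p unfolding alternating_def by blast
    ultimately show ?thesis by (simp add: arc_end_def)
  qed
  have rH: "r x \<in> H \<and> arc_end D (ccw D (r x)) = x" if "x \<in> H" for x
    using that end_facts[of x] end_facts[of "arc_end D x"] arc_over[of x] by (simp add: H_def r_def)
  have injr: "inj_on r H" by (rule inj_on_inverseI[where g = "\<lambda>x. arc_end D (ccw D x)"]) (use rH in auto)
  have rbij: "bij_betw r H H"
    using endo_inj_surj[OF finH image_subsetI injr] injr rH by (simp add: bij_betw_def)
  define R where "R = {(x, arc_end D x) | x. x \<in> strand_ends D} \<union>
    {(x, if pos D (fst x) \<in> {} then A_smoothing D x else B_smoothing D x) | x. x \<in> strand_ends D}"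
  have rel: "state_rel D {} = R\<^sup>* \<inter> strand_ends D \<times> strand_ends D"
    unfolding state_rel_def R_def ..
  have R: "(x, arc_end D x) \<in> R" "(x, B_smoothing D x) \<in> R" if "x \<in> strand_ends D" for x
    using that unfolding R_def empty_iff if_False by blast+
  have R_cases: "y = arc_end D x \<or> y = B_smoothing D x" if "(x, y) \<in> R" for x y
    using that unfolding R_def empty_iff if_False by blast
  have step: "cl (r x) = cl x" if "x \<in> H" for x
  proof -
    have x: "x \<in> strand_ends D" "arc_end D x \<in> strand_ends D" "r x \<in> strand_ends D"
      using that rH[OF that] end_facts by (auto simp: H_def)
    have "r x = B_smoothing D (arc_end D x)"
      using that arc_over[OF x(1)] by (simp add: H_def r_def B_smoothing_def)
    then have "(x, r x) \<in> R\<^sup>*"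
      using R[OF x(1)] R[OF x(2)] by (metis r_into_rtrancl rtrancl_into_rtrancl)
    then have "(x, r x) \<in> state_rel D {}" using x rel by blast
    then show ?thesis unfolding cl_def by (rule equiv_class_eq[OF equiv_state_rel, symmetric])
  qed
  note clr = step
  have orb: "{h' \<in> H. cl h' = cl h} = orbit r h" if h: "h \<in> H" for h
  proof (intro equalityI subsetI)
    fix x assume "x \<in> orbit r h"
    then have "x \<in> H \<and> cl x = cl h"
    proof induction
      case base
      show ?case using step[OF h] rH[OF h] by blast
    next
      case (step y)
      then show ?case using clr[of y] rH[of y] by simp
    qed
    then show "x \<in> {h' \<in> H. cl h' = cl h}" by simp
  next
    fix x assume x: "x \<in> {h' \<in> H. cl h' = cl h}"
    have perm: "(perm_restrict r H) permutes H"
      by (rule bij_imp_permutes)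
        (use rbij in \<open>auto simp: perm_restrict_def bij_betw_def inj_on_def image_def\<close>)
    have orbH: "orbit r h \<subseteq> H"
    proof
      fix y assume "y \<in> orbit r h"
      then show "y \<in> H" by induction (use h rH in blast)+
    qed
    have self: "h \<in> orbit r h"
    proof -
      have "h \<in> orbit (perm_restrict r H) h"
        using perm finH by (meson permutation_permutes permutation_self_in_orbit)
      moreover have "orbit (perm_restrict r H) h = orbit r h"
        by (rule orbit_cong0[of _ H]) (use h rH in \<open>auto simp: perm_restrict_def\<close>)
      ultimately show ?thesis by simp
    qed
    have pre: "\<exists>y0\<in>orbit r h. y = r y0" if "y \<in> orbit r h" for y
      using that by cases (use self in blast)+
    let ?Q = "orbit r h \<union> arc_end D ` orbit r h"
    have closed: "arc_end D y \<in> ?Q \<and> B_smoothing D y \<in> ?Q" if "y \<in> ?Q" for y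
      using that
    proof
      assume y: "y \<in> orbit r h"
      then obtain y0 where y0: "y0 \<in> orbit r h" "y = r y0" using pre by blast
      have "y0 \<in> H" "y \<in> H" using y0 y orbH by blast+
      then have "ccw D y = arc_end D y0" "fst y \<in> over D"
        using y0(2) end_facts(5)[OF end_facts(1)[of y0]] unfolding H_def r_def by simp_all
      then have "B_smoothing D y = arc_end D y0" by (simp add: B_smoothing_def)
      then show ?thesis using y y0(1) by blast
    next
      assume "y \<in> arc_end D ` orbit r h"
      then obtain y0 where y0: "y0 \<in> orbit r h" "y = arc_end D y0" by blast
      have "y0 \<in> H" using y0 orbH by blast
      then have "arc_end D y = y0" "fst y \<notin> over D"
        using y0(2) end_facts(4)[of y0] arc_over[of y0] unfolding H_def by simp_all
      moreover from this have "B_smoothing D y = r y0"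
        using y0(2) unfolding B_smoothing_def r_def by simp
      ultimately show ?thesis using y0(1) orbit.step[of y0 r h] by simp
    qed
    have "x \<in> strand_ends D" "cl x = cl h" using x by (auto simp: H_def)
    then have "x \<in> cl h" using equiv_class_self[OF equiv_state_rel] unfolding cl_def by blast
    then have "(h, x) \<in> R\<^sup>*" unfolding cl_def rel by blast
    then have "x \<in> ?Q"
    proof induction
      case base
      show ?case using self by blast
    next
      case (step y z)
      then show ?case using closed[of y] R_cases[of y z] by blast
    qed
    then show "x \<in> orbit r h"
    proof
      assume "x \<in> arc_end D ` orbit r h"
      then obtain y where "y \<in> H" "x = arc_end D y" using orbH by blast
      then have "fst x \<notin> over D" using arc_over[of y] unfolding H_def by simp
      then show ?thesis using x unfolding H_def by simp
    qed
  qed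
  have cyc: "cyclic_on r {h' \<in> H. cl h' = cl h}" if "h \<in> H" for h
    unfolding cyclic_on_def
  proof
    show "h \<in> {h' \<in> H. cl h' = cl h}" using that by simp
    show "{h' \<in> H. cl h' = cl h} = orbit r h" using orb[OF that] .
  qed
  have two: "card {h \<in> H. pos D (fst h) = z} = 2" if z: "z \<in> classical D" for z
  proof -
    have "\<exists>!p. p \<in> preimages D z \<and> p \<in> over D"
      using z diagram_facts(6) by blast
    then obtain p where p: "p \<in> preimages D z" "p \<in> over D" by blast
    have pz: "pos D p = z" using p(1) unfolding preimages_def by blast
    have pp: "p \<in> passages D" using p(1) z unfolding passages_def by blast
    have "h \<in> {(p, True), (p, False)}" if h: "h \<in> H" "pos D (fst h) = z" for h
    proof -
      have "fst h \<in> passages D" "fst h \<in> over D"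
        using h(1) unfolding H_def strand_ends_def by (simp_all add: mem_Times_iff)
      then have "fst h \<in> {p, partner D p}" "partner D p \<notin> over D"
        using passage_facts(8)[of "fst h"] passage_facts(6,8)[OF pp] p(2) unfolding h(2) pz by blast+
      then have "fst h = p" using \<open>fst h \<in> over D\<close> by (metis insertE singletonD)
      then have "h = (p, snd h)" by (metis prod.collapse)
      then show ?thesis by (cases "snd h") simp_all
    qed
    moreover have "{(p, True), (p, False)} \<subseteq> {h \<in> H. pos D (fst h) = z}"
      using p(2) pp pz unfolding H_def strand_ends_def by simp
    ultimately have "{h \<in> H. pos D (fst h) = z} = {(p, True), (p, False)}" by blast
    then show ?thesis by simp
  qed
  have finC: "finite (classical D)" "finite (comps D)"
    using diagram_facts(1) finite_subset[OF diagram_facts(5,2)] by simp_all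
  have "state_rel D {} \<subseteq> strand_ends D \<times> strand_ends D" unfolding state_rel_def by blast
  then have finV: "finite (state_curves D {})"
    unfolding state_curves_def using finC(2) by (intro finite_Plus finite_quotient finE) simp_all
  have G: "verts ?G = state_curves D {}" "edges ?G = classical D" "ends ?G = H"
    "end_vert ?G = (\<lambda>x. Inl (cl x))" "end_edge ?G = (\<lambda>x. pos D (fst x))" "rot ?G = r"
    "edge_sign ?G = eps"
    unfolding alternating_ribbon_graph_def H_def cl_def r_def by simp_all
  have "Inl (cl x) \<in> state_curves D {}" "pos D (fst x) \<in> classical D" if "x \<in> H" for x
  proof -
    have "x \<in> strand_ends D" using that unfolding H_def by blast
    then show "Inl (cl x) \<in> state_curves D {}"
      unfolding state_curves_def cl_def by (intro InlI quotientI)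
    show "pos D (fst x) \<in> classical D"
      using \<open>x \<in> strand_ends D\<close> passage_facts(1) unfolding strand_ends_def by (simp add: mem_Times_iff)
  qed
  then have "multigraph ?G"
    unfolding multigraph_def G using finV finC(1) finH two by (simp add: image_subset_iff)
  then show ?thesis
    unfolding signed_ribbon_graph_def ribbon_graph_def G using rbij cyc eps by (simp add: inj_eq)
qed

end

end

(*
  Switching the crossings in W exchanges the two splittings there, so the state of D with
  A-splittings at S has the same curves as the state of the alternating diagram with A-splittings at
  the symmetric difference F of S and W.  The curves of the latter are the boundary components of
  the spanning subgraph F: the vertices are the curves of the all-B state, and an A-splitting inserts a
  ribbon.  With d = -a^2 - a^-2 one has -t - 1 = a^2 d and -1/t - 1 = a^-2 d, and the two sums
  agree term by term.

  In the planar case t = -1, that is d = 0, is allowed.  Nullity and genus do not decrease when an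
  edge is added; they vanish on the edgeless subgraph, so every spanning subgraph of a planar ribbon
  graph is planar and the exponents of d can be compared without dividing by d.
*)

theory Submission
  imports Defs
begin

section \<open>Numbers of classes of generated equivalence relations\<close>

text \<open>A state curve is a class of an equivalence relation, a boundary component is a cycle of
  a permutation, and for a spanning subgraph this permutation involves a first-return map.
  Alternation bridges the gap: arcs as well as smoothings then exchange over-ends with under-ends,
  so a curve is determined by its trace on the over-ends, and the trace is one cycle of "arc, then
  smoothing". This cycle follows the rotation of the full ribbon graph, except that at an
  A-splitting it moves on to the opposite end of the ribbon; watched only at the chosen ribbons, it
  is the boundary walk of the subgraph. Curves that miss the chosen ribbons are invisible to the
  walk and are matched with isolated vertices instead.

  Monotonicity of the genus needs that two different curves merge when a ribbon is put between them.
  Since curves are known here only as classes, not as cyclic sequences, this is obtained by counting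
  over-ends against under-ends on a curve that has been cut open.\<close>

definition num_classes :: "'a set \<Rightarrow> ('a \<times> 'a) set \<Rightarrow> nat" where
  "num_classes A r = card (A // (r\<^sup>* \<inter> A \<times> A))"

text \<open>Both \<open>state_rel\<close> and \<open>connected_rel\<close> have this form, so curves
  of states and components of graphs can be counted by the same function.\<close>

lemma equiv_rtrancl_Int:
  assumes "sym r"
  shows "equiv A (r\<^sup>* \<inter> A \<times> A)"
  using sym_rtrancl[OF assms] unfolding equiv_def refl_on_def sym_def trans_def
  by (blast intro: rtrancl_trans)

text \<open>Containment in \<open>s\<^sup>*\<close> instead of \<open>s\<close> is what later uses
  require: one step of a relation gets replaced by a detour of several steps of the other.\<close>

lemma num_classes_antimono:
  assumes "finite A" "sym r" "sym s" "r \<subseteq> s\<^sup>*"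
  shows "num_classes A s \<le> num_classes A r"
proof -
  have "r\<^sup>* \<inter> A \<times> A \<subseteq> s\<^sup>* \<inter> A \<times> A"
    using assms(4) rtrancl_subset_rtrancl by blast
  then show ?thesis
    unfolding num_classes_def using assms(1-3)
    by (intro finite_refines_card_le equiv_rtrancl_Int finite_quotient) auto
qed

text \<open>Sending each fine class to the coarse class around it is onto and takes the same value
  on the classes of \<open>a\<close> and \<open>b\<close>. It therefore stays onto after the class
  of \<open>b\<close> has been dropped.\<close>

lemma num_classes_strict_antimono:
  assumes "finite A" "sym r" "sym s" "r \<subseteq> s\<^sup>*"
    and ab: "a \<in> A" "b \<in> A" "(a, b) \<in> s\<^sup>*" "(a, b) \<notin> r\<^sup>*"
  shows "num_classes A s < num_classes A r"
proof -
  let ?R = "r\<^sup>* \<inter> A \<times> A" and ?S = "s\<^sup>* \<inter> A \<times> A"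
  have R: "equiv A ?R" and S: "equiv A ?S" by (simp_all add: assms equiv_rtrancl_Int)
  have RS: "?R \<subseteq> ?S" using assms(4) rtrancl_subset_rtrancl by blast
  let ?f = "\<lambda>C. ?S `` C" and ?a = "?R `` {a}" and ?b = "?R `` {b}"
  have fin: "finite (A // ?R)" using \<open>finite A\<close> by (simp add: finite_quotient)
  have mem: "?a \<in> A // ?R" "?b \<in> A // ?R" using ab by (simp_all add: quotientI)
  have neq: "?a \<noteq> ?b"
    using ab eq_equiv_class[OF _ R \<open>b \<in> A\<close>, of a] by blast
  have "?f ?a = ?f ?b"
    unfolding refines_equiv_class_eq2[OF RS R S]
    by (rule equiv_class_eq[OF S]) (use ab in blast)
  moreover have "?a \<in> A // ?R - {?b}" using mem neq by blast
  ultimately have "?f ?b \<in> ?f ` (A // ?R - {?b})"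
    by (intro image_eqI[where f = ?f]) (simp_all only:)
  then have "insert (?f ?b) (?f ` (A // ?R - {?b})) = ?f ` (A // ?R - {?b})" by (rule insert_absorb)
  then have "?f ` insert ?b (A // ?R - {?b}) = ?f ` (A // ?R - {?b})" by (simp only: image_insert)
  then have "?f ` (A // ?R) = ?f ` (A // ?R - {?b})" by (simp only: insert_Diff[OF mem(2)])
  then have "A // ?S = ?f ` (A // ?R - {?b})"
    using refines_equiv_image_eq[OF RS R S] by simp
  then have "card (A // ?S) \<le> card (A // ?R - {?b})"
    using card_image_le fin by (metis finite_Diff)
  also have "\<dots> < card (A // ?R)"
    by (rule card_Diff1_less[OF fin mem(2)])
  finally show ?thesis unfolding num_classes_def .
qed

text \<open>Away from the class of \<open>b\<close>, the map from old to new classes is injective: a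
  new connection between points not related to \<open>b\<close> must reach \<open>a\<close> at both
  of its ends, and then it is an old connection.\<close>

lemma num_classes_insert_pair:
  assumes "finite A" "sym r" "b \<in> A"
  shows "num_classes A r \<le> Suc (num_classes A (r \<union> {(a, b), (b, a)}))"
proof -
  define s where "s = r \<union> {(a, b), (b, a)}"
  let ?R = "r\<^sup>* \<inter> A \<times> A" and ?S = "s\<^sup>* \<inter> A \<times> A"
  have "sym s" using \<open>sym r\<close> unfolding s_def sym_def by blast
  have R: "equiv A ?R" and S: "equiv A ?S" by (simp_all add: \<open>sym s\<close> assms equiv_rtrancl_Int)
  have RS: "?R \<subseteq> ?S" using rtrancl_mono[of r s] by (auto simp: s_def)
  have symr: "(y, x) \<in> r\<^sup>*" if "(x, y) \<in> r\<^sup>*" for x y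
    using that sym_rtrancl[OF \<open>sym r\<close>] by (simp add: symD)
  \<comment> \<open>Either the path avoids the new pair, or the pieces before its first and after
    its last use of the pair are paths of \<open>r\<close>.\<close>
  have split: "(x, y) \<in> r\<^sup>* \<or> ((x, a) \<in> r\<^sup>* \<or> (x, b) \<in> r\<^sup>*) \<and> ((a, y) \<in> r\<^sup>* \<or> (b, y) \<in> r\<^sup>*)"
    if "(x, y) \<in> s\<^sup>*" for x y
    using that
  proof induction
    case base
    then show ?case by simp
  next
    case (step y z)
    then show ?case unfolding s_def by (auto intro: rtrancl_into_rtrancl)
  qed
  let ?b = "?R `` {b}"
  have fin: "finite (A // ?R)" "finite (A // ?S)" using \<open>finite A\<close>
    by (simp_all add: finite_quotient)
  have "inj_on (\<lambda>C. ?S `` C) (A // ?R - {?b})"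
  proof (rule inj_onI)
    fix C C' assume C: "C \<in> A // ?R - {?b}" and C': "C' \<in> A // ?R - {?b}"
      and eq: "?S `` C = ?S `` C'"
    obtain x where x: "x \<in> A" "C = ?R `` {x}" using C by (auto elim: quotientE)
    obtain y where y: "y \<in> A" "C' = ?R `` {y}" using C' by (auto elim: quotientE)
    have "?S `` {x} = ?S `` {y}"
      using eq unfolding x(2) y(2) refines_equiv_class_eq2[OF RS R S] .
    then have "(x, y) \<in> s\<^sup>*" using eq_equiv_class[OF _ S y(1)] by blast
    moreover have "(x, b) \<notin> r\<^sup>*"
      using C x equiv_class_eq[OF R, of x b] \<open>b \<in> A\<close> by auto
    moreover have "(b, y) \<notin> r\<^sup>*"
      using C' y equiv_class_eq[OF R, of b y] \<open>b \<in> A\<close> by auto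
    ultimately have "(x, y) \<in> r\<^sup>*" using split[of x y] by (meson rtrancl_trans)
    then show "C = C'" using x y equiv_class_eq[OF R, of x y] by simp
  qed
  moreover have "(\<lambda>C. ?S `` C) ` (A // ?R - {?b}) \<subseteq> A // ?S"
    using refines_equiv_image_eq[OF RS R S] by blast
  ultimately have "card (A // ?R - {?b}) \<le> card (A // ?S)"
    using fin card_inj_on_le by blast
  then show ?thesis unfolding num_classes_def s_def[symmetric]
    using fin(1) \<open>b \<in> A\<close> by (simp add: card_Diff_singleton quotientI)
qed

section \<open>Pairs of involutions\<close>

text \<open>Intended for the over-ends as \<open>H\<close>. Walking along a curve by turns with two
  such involutions, one is in \<open>H\<close> at every second step, always about to apply the same
  involution; this orients the curve.\<close>

definition swap_inv :: "'a set \<Rightarrow> 'a set \<Rightarrow> ('a \<Rightarrow> 'a) \<Rightarrow> bool" where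
  "swap_inv X H f \<longleftrightarrow> (\<forall>x\<in>X. f x \<in> X \<and> f (f x) = x \<and> (f x \<in> H \<longleftrightarrow> x \<notin> H))"

definition step_rel :: "'a set \<Rightarrow> ('a \<Rightarrow> 'a) \<Rightarrow> ('a \<Rightarrow> 'a) \<Rightarrow> ('a \<times> 'a) set" where
  "step_rel X f g = {(x, f x) | x. x \<in> X} \<union> {(x, g x) | x. x \<in> X}"

lemma swap_invD:
  assumes "swap_inv X H f" "x \<in> X"
  shows "f x \<in> X" "f (f x) = x" "f x \<in> H \<longleftrightarrow> x \<notin> H"
  using assms unfolding swap_inv_def by blast+

lemma sym_step_rel: "swap_inv X H f \<Longrightarrow> swap_inv X H g \<Longrightarrow> sym (step_rel X f g)"
  unfolding sym_def step_rel_def swap_inv_def by auto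

lemma in_step_rel: "x \<in> X \<Longrightarrow> (x, f x) \<in> step_rel X f g" "x \<in> X \<Longrightarrow> (x, g x) \<in> step_rel X f g"
  unfolding step_rel_def by blast+

text \<open>\<open>orbit f x\<close> starts with \<open>f x\<close>, so \<open>x\<close> belongs to
  it only because \<open>f\<close> permutes the finite set \<open>H\<close>.\<close>

lemma self_in_orbit_finite:
  assumes "finite H" "inj_on f H" "f ` H \<subseteq> H" "x \<in> H"
  shows "x \<in> orbit f x"
proof -
  have "bij_betw f H H" using assms by (simp add: bij_betw_def endo_inj_surj)
  then have "perm_restrict f H permutes H"
    by (intro bij_imp_permutes) (auto simp: perm_restrict_def bij_betw_def inj_on_def image_def)
  then have "x \<in> orbit (perm_restrict f H) x"
    using \<open>finite H\<close> by (meson permutation_permutes permutation_self_in_orbit)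
  moreover have "orbit (perm_restrict f H) x = orbit f x"
    by (rule orbit_cong0[of _ H]) (use assms in \<open>auto simp: perm_restrict_def\<close>)
  ultimately show ?thesis by simp
qed

lemma swap_inv_comp:
  assumes "swap_inv X H f" "swap_inv X H g"
  shows "inj_on (g \<circ> f) (X \<inter> H)" "(g \<circ> f) ` (X \<inter> H) \<subseteq> X \<inter> H"
proof -
  show "inj_on (g \<circ> f) (X \<inter> H)"
    by (rule inj_on_inverseI[where g = "f \<circ> g"]) (use assms in \<open>auto simp: swap_inv_def\<close>)
  show "(g \<circ> f) ` (X \<inter> H) \<subseteq> X \<inter> H"
    using assms by (auto simp: swap_inv_def)
qed

lemma rtrancl_step_rel_iff_orbit:
  assumes fg: "swap_inv X H f" "swap_inv X H g" and "finite X" and x: "x \<in> X \<inter> H" and y: "y \<in> H"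
  shows "(x, y) \<in> (step_rel X f g)\<^sup>* \<longleftrightarrow> y \<in> orbit (g \<circ> f) x"
proof
  let ?p = "g \<circ> f"
  note p = swap_inv_comp[OF fg]
  have self: "x \<in> orbit ?p x"
    using self_in_orbit_finite[OF _ p x] \<open>finite X\<close> by blast
  have orbH: "y \<in> X \<inter> H" if "y \<in> orbit ?p x" for y
    using that by induction (use x p in blast)+
  have pre: "\<exists>y0\<in>orbit ?p x. y = ?p y0" if "y \<in> orbit ?p x" for y
    using that by cases (use self in blast)+
  \<comment> \<open>The whole curve through \<open>x\<close>: the cycle lies in \<open>H\<close>,
    its image under \<open>f\<close> outside. Closure under \<open>g\<close> uses that every point
    of the cycle has a predecessor on it.\<close>
  let ?Q = "orbit ?p x \<union> f ` orbit ?p x"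
  have closed: "f y \<in> ?Q \<and> g y \<in> ?Q" if "y \<in> ?Q" for y
    using that
  proof
    assume y: "y \<in> orbit ?p x"
    then obtain y0 where y0: "y0 \<in> orbit ?p x" "y = g (f y0)" using pre[OF y] by auto
    then have "g y = f y0" using swap_invD[OF fg(1), of y0] swap_invD[OF fg(2), of
      "f y0"] orbH[of y0] by simp
    then show ?thesis using y y0(1) by blast
  next
    assume "y \<in> f ` orbit ?p x"
    then obtain y0 where y0: "y0 \<in> orbit ?p x" "y = f y0" by blast
    then have "f y = y0" using swap_invD[OF fg(1), of y0] orbH[of y0] by simp
    then show ?thesis using y0 orbit.step[of y0 ?p x] by simp
  qed
  assume "(x, y) \<in> (step_rel X f g)\<^sup>*"
  then have "y \<in> ?Q"
  proof induction
    case base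
    show ?case using self by blast
  next
    case (step y z)
    then have "z = f y \<or> z = g y" unfolding step_rel_def by blast
    then show ?case using closed[OF step.IH] by blast
  qed
  then show "y \<in> orbit ?p x"
    using y orbH swap_invD(3)[OF fg(1)] by blast
next
  assume "y \<in> orbit (g \<circ> f) x"
  then have "y \<in> X \<and> (x, y) \<in> (step_rel X f g)\<^sup>*"
  proof induction
    case base
    have "x \<in> X" "f x \<in> X" "g (f x) \<in> X" using x fg by (auto simp: swap_inv_def)
    then show ?case
      using in_step_rel[of x X f g] in_step_rel[of "f x" X g f] in_step_rel(2)[of "f x" X g f]
      by (metis comp_apply in_step_rel(2) r_into_rtrancl rtrancl.rtrancl_into_rtrancl)
  next
    case (step y)
    have "f y \<in> X" "g (f y) \<in> X" using step fg by (auto simp: swap_inv_def)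
    then show ?case
      using step by (metis comp_apply in_step_rel rtrancl.rtrancl_into_rtrancl)
  qed
  then show "(x, y) \<in> (step_rel X f g)\<^sup>*" by simp
qed

text \<open>The map \<open>p\<close> runs along \<open>r\<close> outside \<open>Y\<close> and
  applies \<open>opp\<close> on reaching \<open>Y\<close>, so its own first return to
  \<open>Y\<close> is \<open>opp \<circ> f\<close>. Conjugation by \<open>opp\<close> turns this
  into \<open>f \<circ> opp\<close>, which explains the shift by \<open>opp\<close> on one side of
  the equivalence.\<close>

lemma first_return_orbit_iff:
  fixes r opp :: "'a \<Rightarrow> 'a"
  assumes "finite H" "inj_on r H" "r ` H \<subseteq> H" "Y \<subseteq> H"
    and opp: "\<And>y. y \<in> Y \<Longrightarrow> opp y \<in> Y \<and> opp (opp y) = y"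
    and p: "\<And>h. h \<in> H \<Longrightarrow> p h = (if r h \<in> Y then opp (r h) else r h)"
    and f: "\<And>h. h \<in> Y \<Longrightarrow> f h = (r ^^ (LEAST n. 0 < n \<and> (r ^^ n) h \<in> Y)) h"
    and y: "y \<in> Y" "y' \<in> Y"
  shows "opp y' \<in> orbit p (opp y) \<longleftrightarrow> y' \<in> orbit (f \<circ> opp) y"
proof
  let ?O = "orbit (f \<circ> opp) y"
  have rn: "(r ^^ n) h \<in> H" if "h \<in> H" for n h
    using that by (induction n) (use assms(3) in auto)
  have fret: "f h = (r ^^ n) h"
    if "h \<in> Y" "0 < n" "(r ^^ n) h \<in> Y" "\<And>i. 0 < i \<Longrightarrow> i < n \<Longrightarrow> (r ^^ i) h \<notin> Y" for h n
  proof -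
    have "(LEAST n. 0 < n \<and> (r ^^ n) h \<in> Y) = n"
      using that by (intro Least_equality) (auto simp: not_less[symmetric])
    then show ?thesis using f that by simp
  qed
  have orbit_walk: "(r ^^ Suc n) h \<in> orbit p h"
    if "h \<in> Y" "\<And>i. 0 < i \<Longrightarrow> i < Suc (Suc n) \<Longrightarrow> (r ^^ i) h \<notin> Y" for h n
    using that
  proof (induction n)
    case 0
    have "r h \<notin> Y" using 0(2)[of "Suc 0"] by simp
    then have "p h = r h" using p[of h] 0(1) assms(4) by auto
    then show ?case by (metis funpow_0 funpow_simps_right(2) comp_apply orbit.base)
  next
    case (Suc n)
    have "(r ^^ Suc n) h \<in> H" using rn Suc.prems(1) assms(4) by blast
    moreover have "r ((r ^^ Suc n) h) \<notin> Y" using Suc.prems(2)[of "Suc (Suc n)"] by simp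
    ultimately have "(r ^^ Suc (Suc n)) h = p ((r ^^ Suc n) h)" using p by simp
    then show ?case using Suc.IH[OF Suc.prems(1)] Suc.prems(2) by (simp add: orbit.step)
  qed
  have step_opp: "f h \<in> Y \<and> opp (f h) \<in> orbit p h" if h: "h \<in> Y" for h
  proof -
    \<comment> \<open>Since \<open>h\<close> comes back to itself along its \<open>r\<close>-cycle,
      the \<open>LEAST\<close> defining the first return ranges over a nonempty set.\<close>
    have "h \<in> orbit r h"
      by (rule self_in_orbit_finite[OF assms(1-3)]) (use assms(4) h in blast)
    then have "(r ^^ funpow_dist1 r h h) h \<in> Y" using h by (simp only: funpow_dist1_prop)
    then have ex: "\<exists>m. 0 < m \<and> (r ^^ m) h \<in> Y" by (intro exI conjI) (rule zero_less_Suc)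
    define n where "n = (LEAST n. 0 < n \<and> (r ^^ n) h \<in> Y)"
    have n: "0 < n" "(r ^^ n) h \<in> Y" "f h = (r ^^ n) h"
      using LeastI_ex[OF ex] f[OF h] unfolding n_def by auto
    have nl: "(r ^^ i) h \<notin> Y" if "0 < i" "i < n" for i
      using not_less_Least[of i "\<lambda>n. 0 < n \<and> (r ^^ n) h \<in> Y"] that unfolding n_def by blast
    obtain k where k: "n = Suc k" using n(1) by (cases n) auto
    have pk: "p ((r ^^ k) h) = opp (f h)"
      using p[OF rn[of h k]] n h assms(4) unfolding k by auto
    have "opp (f h) \<in> orbit p h"
    proof (cases k)
      case 0
      then show ?thesis using pk orbit.base[of p h] by simp
    next
      case (Suc j)
      then have "(r ^^ k) h \<in> orbit p h" using orbit_walk[OF h, of j] nl k by auto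
      then show ?thesis using pk orbit.step[of "(r ^^ k) h" p h] by simp
    qed
    then show ?thesis using n by simp
  qed
  show "opp y' \<in> orbit p (opp y)" if "y' \<in> ?O"
  proof -
    from that have "y' \<in> Y \<and> opp y' \<in> orbit p (opp y)"
    proof induction
      case base
      then show ?case using step_opp[of "opp y"] opp[OF y(1)] by simp
    next
      case (step z)
      then show ?case using step_opp[of "opp z"] opp[of z] by (auto intro: orbit_trans)
    qed
    then show ?thesis by simp
  qed
  \<comment> \<open>Invariant of the walk along \<open>p\<close>: the point lies on the
    \<open>r\<close>-stretch that starts at \<open>opp y0\<close> and has not met \<open>Y\<close>
    again. The alternative \<open>y0 = y\<close> is the starting stretch, because
    \<open>orbit\<close> begins only with the image of \<open>y\<close>.\<close>
  define J where "J h \<longleftrightarrow> (\<exists>y0 k. (y0 = y \<or> y0 \<in> ?O) \<and> y0 \<in> Y \<and> h = (r ^^ k) (opp y0) \<and>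
    (\<forall>i. 0 < i \<longrightarrow> i \<le> k \<longrightarrow> (r ^^ i) (opp y0) \<notin> Y))" for h
  have Jstep: "J (p h) \<and> (p h \<in> Y \<longrightarrow> opp (p h) \<in> ?O)" if Jh: "J h" for h
  proof -
    obtain y0 k where y0: "y0 = y \<or> y0 \<in> ?O" "y0 \<in> Y" "h = (r ^^ k) (opp y0)"
        "\<And>i. 0 < i \<Longrightarrow> i \<le> k \<Longrightarrow> (r ^^ i) (opp y0) \<notin> Y"
      using Jh unfolding J_def by blast
    have "h \<in> H" unfolding y0(3) using rn opp y0(2) assms(4) by blast
    show ?thesis
    proof (cases "r h \<in> Y")
      case True
      have rh: "(r ^^ Suc k) (opp y0) = r h" unfolding y0(3) by simp
      have "f (opp y0) = (r ^^ Suc k) (opp y0)"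
        by (rule fret) (use y0(2,4) opp[OF y0(2)] True rh in \<open>simp_all only: less_Suc_eq_le
          zero_less_Suc not_False_eq_True\<close>)
      then have "f (opp y0) = r h" unfolding rh .
      then have "(f \<circ> opp) y0 = r h" by simp
      with y0(1) have O: "r h \<in> ?O"
        using orbit.base[of "f \<circ> opp" y] orbit.step[of y0 "f \<circ> opp" y] by metis
      then have "J (opp (r h))" unfolding J_def using True
        by (intro exI[of _ "r h"] exI[of _ 0]) simp
      moreover have "p h = opp (r h)" using p[OF \<open>h \<in> H\<close>] True by (simp only: if_True)
      ultimately show ?thesis using O opp[OF True] by simp
    next
      case False
      then have "(r ^^ i) (opp y0) \<notin> Y" if "0 < i" "i \<le> Suc k" for i
        using y0(3,4) that by (cases "i = Suc k") auto
      then have "J (r h)" unfolding J_def using y0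
        by (intro exI[of _ y0] exI[of _ "Suc k"]) simp
      moreover have "p h = r h" using p[OF \<open>h \<in> H\<close>] False by (simp only: if_False)
      ultimately show ?thesis using False by simp
    qed
  qed
  have "J (opp y)" unfolding J_def using y by (intro exI[of _ y] exI[of _ 0]) simp
  show "y' \<in> ?O" if "opp y' \<in> orbit p (opp y)"
  proof -
    have "J x \<and> (x \<in> Y \<longrightarrow> opp x \<in> ?O)" if "x \<in> orbit p (opp y)" for x
      using that by induction (use Jstep \<open>J (opp y)\<close> in blast)+
    then show ?thesis using that opp y by metis
  qed
qed

text \<open>Two connections are cut and rejoined crosswise. Adding the single pair of
  \<open>x1\<close> and \<open>g x1\<close> to the new relation links all four points and thereby
  restores the old connections, at the cost of at most one class. If \<open>x1\<close> and
  \<open>x2\<close> lie on different old curves, that pair is connected in the new relation anyway,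
  around the rest of the curve of \<open>x1\<close>; the new relation is then a proper coarsening of
  the old one.\<close>

lemma num_classes_reconnect:
  assumes "finite X" and f: "swap_inv X H f" and g: "swap_inv X H g" and g': "swap_inv X H g'"
    and x: "x1 \<in> X \<inter> H" "x2 \<in> X \<inter> H" "x1 \<noteq> x2"
    and g'x: "g' x1 = g x2" "g' x2 = g x1"
    and g'_eq: "\<And>x. x \<in> X \<Longrightarrow> x \<notin> {x1, x2, g x1, g x2} \<Longrightarrow> g' x = g x"
  shows "num_classes X (step_rel X f g') \<le> Suc (num_classes X (step_rel X f g))"
    and "(x1, x2) \<notin> (step_rel X f g)\<^sup>* \<Longrightarrow>
      num_classes X (step_rel X f g') < num_classes X (step_rel X f g)"
proof -
  let ?S = "step_rel X f g" and ?T = "step_rel X f g'"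
  define U where "U = ?T \<union> {(x1, g x1), (g x1, x1)}"
  have symS: "sym ?S" and symT: "sym ?T" using sym_step_rel f g g' by blast+
  have symU: "sym U" using symT unfolding U_def sym_def by blast
  have gx: "g x1 \<in> X" "g x2 \<in> X" "g (g x1) = x1" "g (g x2) = x2"
    "g' (g x1) = x2" "g' (g x2) = x1"
    using x swap_invD[OF g] swap_invD[OF g'] g'x by (metis IntE)+
  have T: "(x2, g x1) \<in> ?T" "(g x1, x2) \<in> ?T" "(x1, g x2) \<in> ?T" "(g x2, x1) \<in> ?T"
    using in_step_rel(2)[of _ X g' f] x gx g'x by (metis IntE)+
  have SU: "?S \<subseteq> U\<^sup>*"
  proof -
    have U: "(x1, g x1) \<in> U" "(g x1, x1) \<in> U" "(x2, g x1) \<in> U" "(g x1, x2) \<in> U"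
      "(x1, g x2) \<in> U" "(g x2, x1) \<in> U"
      using T unfolding U_def by blast+
    have 22: "(x2, g x2) \<in> U\<^sup>*" "(g x2, x2) \<in> U\<^sup>*"
      using U by (meson r_into_rtrancl rtrancl_trans)+
    have "(x, g x) \<in> U\<^sup>*" if "x \<in> X" for x
    proof (cases "x \<in> {x1, x2, g x1, g x2}")
      case True
      then show ?thesis using U 22 gx by auto
    next
      case False
      then show ?thesis using g'_eq[OF that] in_step_rel(2)[OF that, of g' f] unfolding U_def
        by auto
    qed
    then show ?thesis using in_step_rel(1)[of _ X f g'] by (auto simp: step_rel_def U_def)
  qed
  have "num_classes X ?T \<le> Suc (num_classes X U)"
    unfolding U_def by (rule num_classes_insert_pair[OF \<open>finite X\<close> symT gx(1)])
  also have "num_classes X U \<le> num_classes X ?S"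
    by (rule num_classes_antimono[OF \<open>finite X\<close> symS symU SU])
  finally show "num_classes X ?T \<le> Suc (num_classes X ?S)" by simp
  show "num_classes X ?T < num_classes X ?S" if not: "(x1, x2) \<notin> ?S\<^sup>*"
  proof -
    \<comment> \<open>\<open>R\<close> is the old relation cut open at the four points, hence
      contained in the old and in the new one; \<open>C\<close> is what can still be reached from
      \<open>x1\<close>.\<close>
    define Z where "Z = X - {x1, x2, g x1, g x2}"
    define R where "R = {(x, f x) | x. x \<in> X} \<union> {(x, g x) | x. x \<in> Z}"
    have RS: "R \<subseteq> ?S" unfolding R_def Z_def step_rel_def by blast
    have "R \<subseteq> ?T" unfolding R_def Z_def step_rel_def using g'_eq by auto
    define C where "C = R\<^sup>* `` {x1}"
    have C_f: "f y \<in> C" if "y \<in> C" "y \<in> X" for y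
    proof -
      have "(y, f y) \<in> R" using that unfolding R_def by blast
      then show ?thesis using that unfolding C_def by (auto intro: rtrancl_into_rtrancl)
    qed
    have C_g: "g y \<in> C" if "y \<in> C" "y \<in> Z" for y
    proof -
      have "(y, g y) \<in> R" using that unfolding R_def by blast
      then show ?thesis using that unfolding C_def by (auto intro: rtrancl_into_rtrancl)
    qed
    have CX: "C \<subseteq> X"
    proof
      fix y assume "y \<in> C"
      then have "(x1, y) \<in> R\<^sup>*" by (simp add: C_def)
      then show "y \<in> X"
        by induction (use x in \<open>auto simp: R_def Z_def swap_invD[OF f] swap_invD[OF g]\<close>)
    qed
    have "x1 \<in> C" by (simp add: C_def)
    have CS: "C \<subseteq> ?S\<^sup>* `` {x1}" unfolding C_def using rtrancl_mono[OF RS] by blast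
    then have "x2 \<notin> C" using CS not by blast
    have "(g x2, x2) \<in> ?S" using in_step_rel(2)[of "g x2" X g f] gx by simp
    then have "g x2 \<notin> C"
      using not CS by (meson Image_singleton_iff rtrancl_into_rtrancl subsetD)
    \<comment> \<open>\<open>f\<close> matches the points of \<open>C\<close> inside \<open>H\<close> with those outside,
      and so does \<open>g\<close> except at the four reconnected points; hence \<open>x1\<close> cannot be the only one of these in \<open>C\<close>.\<close>
    have "g x1 \<in> C"
    proof (rule ccontr)
      assume n: "g x1 \<notin> C"
      have finC: "finite C" using CX \<open>finite X\<close> by (rule finite_subset)
      have "bij_betw f (C \<inter> H) (C - H)"
        by (rule bij_betw_byWitness[where f' = f]) (use CX C_f swap_invD[OF f] in blast)+
      then have 1: "card (C \<inter> H) = card (C - H)" by (rule bij_betw_same_card)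
      have CZ: "y \<in> Z \<longleftrightarrow> y \<noteq> x1" if "y \<in> C" for y
        using that CX \<open>x2 \<notin> C\<close> \<open>g x2 \<notin> C\<close> n unfolding Z_def by blast
      have gZ: "g y \<noteq> x1" if "y \<in> C" for y
        using that n CX swap_invD[OF g, of y] by auto
      have "bij_betw g (C \<inter> H - {x1}) (C - H)"
      proof (rule bij_betw_byWitness[where f' = g])
        show "g ` (C \<inter> H - {x1}) \<subseteq> C - H"
          using C_g CZ CX swap_invD[OF g] by blast
        show "g ` (C - H) \<subseteq> C \<inter> H - {x1}"
          using C_g CZ CX swap_invD[OF g] gZ x(1) by blast
      qed (use CX swap_invD[OF g] in blast)+
      then have "card (C \<inter> H - {x1}) = card (C - H)" by (rule bij_betw_same_card)
      then show False using 1 finC \<open>x1 \<in> C\<close> x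
        by (metis IntE IntI card_Diff1_less finite_Int less_irrefl)
    qed
    then have g1: "(x1, g x1) \<in> ?T\<^sup>*"
      using rtrancl_mono[OF \<open>R \<subseteq> ?T\<close>] by (auto simp: C_def)
    then have "U \<subseteq> ?T\<^sup>*"
      unfolding U_def using sym_rtrancl[OF symT] by (auto dest: symD)
    then have "?S \<subseteq> ?T\<^sup>*" using SU rtrancl_subset_rtrancl by blast
    moreover have "(x1, x2) \<in> ?T\<^sup>*" using g1 T(2) by (rule rtrancl_into_rtrancl)
    ultimately show ?thesis
      using num_classes_strict_antimono[OF \<open>finite X\<close> symS symT] x not by blast
  qed
qed

section \<open>Strand ends of a diagram\<close>

definition smoothing :: "'i diagram \<Rightarrow> complex set \<Rightarrow> 'i strand_end \<Rightarrow> 'i strand_end" where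
  "smoothing D S x = (if pos D (fst x) \<in> S then A_smoothing D x else B_smoothing D x)"

abbreviation state_step :: "'i diagram \<Rightarrow> complex set \<Rightarrow> ('i strand_end \<times> 'i strand_end) set" where
  "state_step D S \<equiv> step_rel (strand_ends D) (arc_end D) (smoothing D S)"

definition over_ends :: "'i diagram \<Rightarrow> 'i strand_end set" where
  "over_ends D = {x \<in> strand_ends D. fst x \<in> over D}"

definition free_comps :: "'i diagram \<Rightarrow> 'i set" where
  "free_comps D = {i \<in> comps D. \<forall>s. (i, s) \<notin> passages D}"

text \<open>The continuation straight through the crossing. For an over-end this is the other end of
  the same ribbon, attached in the opposite black angle.\<close>

definition opp_end :: "'i strand_end \<Rightarrow> 'i strand_end" where
  "opp_end x = (fst x, \<not> snd x)"

lemma fst_opp_end [simp]: "fst (opp_end x) = fst x"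
  and opp_end_opp_end [simp]: "opp_end (opp_end x) = x"
  and opp_end_neq [simp]: "opp_end x \<noteq> x"
  by (simp_all add: opp_end_def prod_eq_iff)

lemma state_rel_eq: "state_rel D S = (state_step D S)\<^sup>* \<inter> strand_ends D \<times> strand_ends D"
  unfolding state_rel_def step_rel_def smoothing_def ..

lemma det2_minus_left [simp]: "det2 (- u) v = - det2 u v"
  and det2_commute: "det2 v u = - det2 u v"
  by (simp_all add: det2_def)

text \<open>Reversing a direction changes the sign of the determinant. Consequently a change of
  splitting makes the two ends of a strand exchange their smoothing partners.\<close>

lemma cw_opp_end: "cw D (opp_end x) = ccw D x" and ccw_opp_end: "ccw D (opp_end x) = cw D x"
  by (auto simp: cw_def ccw_def opp_end_def direction_def Let_def)

locale link_diagram =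
  fixes D :: "'i diagram"
  assumes diagram: "virtual_link_diagram D"
begin

lemma finite_comps: "finite (comps D)"
  and finite_double_points: "finite (double_points D)"
  and card_preimages: "\<forall>z\<in>double_points D. card (preimages D z) = 2"
  and transversal: "\<forall>z\<in>double_points D. \<forall>p\<in>preimages D z. \<forall>q\<in>preimages D z.
    p \<noteq> q \<longrightarrow> det2 (velocity D p) (velocity D q) \<noteq> 0"
  and classical_double: "classical D \<subseteq> double_points D"
  and over_subset: "over D \<subseteq> passages D"
  and ex1_over: "\<forall>z\<in>classical D. \<exists>!p. p \<in> preimages D z \<and> p \<in> over D"
  using diagram unfolding virtual_link_diagram_def passages_def by - (elim conjE, assumption)+

lemma finite_classical: "finite (classical D)"
  using finite_double_points classical_double by (rule finite_subset[rotated])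

lemma finite_passages: "finite (passages D)"
proof -
  have "finite (preimages D z)" if "z \<in> classical D" for z
    using card_preimages classical_double that by (metis card.infinite subsetD zero_neq_numeral)
  then show ?thesis unfolding passages_def using finite_classical by blast
qed

lemma finite_strand_ends: "finite (strand_ends D)"
  using finite_passages by (simp add: strand_ends_def)

lemma passage_partner:
  assumes "p \<in> passages D"
  shows "pos D p \<in> classical D" "partner D p \<in> passages D" "partner D p \<noteq> p"
    "partner D (partner D p) = p" "pos D (partner D p) = pos D p"
    "partner D p \<in> over D \<longleftrightarrow> p \<notin> over D"
    "det2 (velocity D p) (velocity D (partner D p)) \<noteq> 0"
    "preimages D (pos D p) = {p, partner D p}"
proof -
  obtain z where z: "z \<in> classical D" "p \<in> preimages D z" using assms passages_def by blast
  have zp: "z = pos D p" using z(2) by (simp add: preimages_def)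
  show c: "pos D p \<in> classical D" using z zp by simp
  have dp: "pos D p \<in> double_points D" using c classical_double by blast
  obtain u v where "preimages D (pos D p) = {u, v}" "u \<noteq> v"
    using bspec[OF card_preimages dp] by (auto simp only: card_2_iff)
  moreover have "p \<in> preimages D (pos D p)" using z(2) zp by simp
  ultimately obtain q where q: "preimages D (pos D p) = {p, q}" "q \<noteq> p"
    by (metis insertE insert_commute singletonD)
  have pq: "partner D p = q" unfolding partner_def using q by (intro the_equality) auto
  have posq: "pos D q = pos D p" using q(1) unfolding preimages_def by blast
  show "partner D p \<in> passages D" using q(1) c pq unfolding passages_def by blast
  show "partner D p \<noteq> p" "pos D (partner D p) = pos D p"
    "preimages D (pos D p) = {p, partner D p}" using pq posq q by auto
  show "partner D (partner D p) = p"
    unfolding pq unfolding partner_def posq using q by (intro the_equality) auto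
  show "partner D p \<in> over D \<longleftrightarrow> p \<notin> over D" using bspec[OF ex1_over c] unfolding pq q(1) using q(2)
    by blast
  have "p \<in> preimages D (pos D p)" "q \<in> preimages D (pos D p)" using q(1) by auto
  from bspec[OF bspec[OF bspec[OF transversal dp] this(1)] this(2)]
  show "det2 (velocity D p) (velocity D (partner D p)) \<noteq> 0" unfolding pq using q(2) by simp
qed

lemma next_prev_passage:
  assumes "p \<in> passages D"
  shows "next_passage D p \<in> passages D" "prev_passage D p \<in> passages D"
    "prev_passage D (next_passage D p) = p" "next_passage D (prev_passage D p) = p"
proof -
  obtain i s where p: "p = (i, s)" by force
  define T where "T = {t. (i, t) \<in> passages D}"
  have fin: "finite T"
    unfolding T_def by (rule finite_subset[OF _ finite_imageI[OF finite_passages, of snd]]) force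
  have sT: "s \<in> T" using assms p T_def by simp
  then have T: "Min T \<in> T" "Max T \<in> T" "\<And>u. u \<in> T \<Longrightarrow> Min T \<le> u \<and> u \<le> Max T" using fin
    by (auto intro: Min_in Max_in)
  define N where "N t = (if \<exists>u\<in>T. t < u then Min {u \<in> T. t < u} else Min T)" for t
  define M where "M t = (if \<exists>u\<in>T. u < t then Max {u \<in> T. u < t} else Max T)" for t
  have nx: "next_passage D (i, t) = (i, N t)" for t
    unfolding next_passage_def N_def Let_def fst_conv snd_conv T_def[symmetric] ..
  have pv: "prev_passage D (i, t) = (i, M t)" for t
    unfolding prev_passage_def M_def Let_def fst_conv snd_conv T_def[symmetric] ..
  have N1: "N t \<in> T \<and> t < N t \<and> (\<forall>u\<in>T. t < u \<longrightarrow> N t \<le> u)" if ex: "\<exists>u\<in>T. t < u" for t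
  proof -
    have "Min {u \<in> T. t < u} \<in> {u \<in> T. t < u}" by (rule Min_in) (use ex fin in auto)
    then show ?thesis using ex fin unfolding N_def by auto
  qed
  have M1: "M t \<in> T \<and> M t < t \<and> (\<forall>u\<in>T. u < t \<longrightarrow> u \<le> M t)" if ex: "\<exists>u\<in>T. u < t" for t
  proof -
    have "Max {u \<in> T. u < t} \<in> {u \<in> T. u < t}" by (rule Max_in) (use ex fin in auto)
    then show ?thesis using ex fin unfolding M_def by auto
  qed
  have N2: "N t = Min T" if "\<not> (\<exists>u\<in>T. t < u)" for t using that unfolding N_def by simp
  have M2: "M t = Max T" if "\<not> (\<exists>u\<in>T. u < t)" for t using that unfolding M_def by simp
  have NT: "N s \<in> T" and MT: "M s \<in> T" using N1 N2 M1 M2 T by metis+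
  then show "next_passage D p \<in> passages D" "prev_passage D p \<in> passages D"
    using p nx pv T_def by auto
  have "M (N s) = s"
  proof (cases "\<exists>u\<in>T. s < u")
    case True
    with sT N1[OF True] M1[of "N s"] show ?thesis by (meson antisym_conv not_less)
  next
    case False
    \<comment> \<open>Here \<open>s\<close> is the largest parameter, so \<open>N\<close> has
      wrapped round to the smallest one and \<open>M\<close> wraps back.\<close>
    then have "\<not> (\<exists>u\<in>T. u < N s)" using N2 T by (metis not_less)
    then show ?thesis using M2 False sT T by (metis antisym_conv not_less)
  qed
  then show "prev_passage D (next_passage D p) = p" using p nx pv by simp
  have "N (M s) = s"
  proof (cases "\<exists>u\<in>T. u < s")
    case True
    with sT M1[OF True] N1[of "M s"] show ?thesis by (meson antisym_conv not_less)
  next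
    case False
    then have "\<not> (\<exists>u\<in>T. M s < u)" using M2 T by (metis not_less)
    then show ?thesis using N2 False sT T by (metis antisym_conv not_less)
  qed
  then show "next_passage D (prev_passage D p) = p" using p nx pv by simp
qed

lemma fst_strand_end: "x \<in> strand_ends D \<Longrightarrow> fst x \<in> passages D"
  by (auto simp: strand_ends_def)

lemma arc_end:
  assumes "x \<in> strand_ends D"
  shows "arc_end D x \<in> strand_ends D" "arc_end D (arc_end D x) = x"
  using next_prev_passage[OF fst_strand_end[OF assms]] assms
  by (auto simp: arc_end_def strand_ends_def prod_eq_iff)

lemma fst_cw: "fst (cw D x) = partner D (fst x)" and fst_ccw: "fst (ccw D x) = partner D (fst x)"
  by (simp_all add: cw_def ccw_def Let_def)

lemma cw_ccw:
  assumes "x \<in> strand_ends D"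
  shows "cw D x \<in> strand_ends D" "ccw D x \<in> strand_ends D" "opp_end x \<in> strand_ends D"
    "cw D (ccw D x) = x" "ccw D (cw D x) = x" "opp_end (cw D x) = ccw D x"
    "pos D (fst (cw D x)) = pos D (fst x)" "pos D (fst (ccw D x)) = pos D (fst x)"
    "fst (cw D x) \<in> over D \<longleftrightarrow> fst x \<notin> over D" "fst (ccw D x) \<in> over D \<longleftrightarrow> fst x \<notin> over D"
proof -
  obtain p b where x: "x = (p, b)" by (cases x)
  have p: "p \<in> passages D" using assms x by (simp add: strand_ends_def)
  note pp = passage_partner[OF p]
  show "cw D x \<in> strand_ends D" "ccw D x \<in> strand_ends D" "opp_end x \<in> strand_ends D"
    using pp p by (simp_all add: x cw_def ccw_def opp_end_def strand_ends_def Let_def)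
  show "pos D (fst (cw D x)) = pos D (fst x)" "pos D (fst (ccw D x)) = pos D (fst x)"
    "fst (cw D x) \<in> over D \<longleftrightarrow> fst x \<notin> over D" "fst (ccw D x) \<in> over D \<longleftrightarrow> fst x \<notin> over D"
    using pp by (simp_all add: fst_cw fst_ccw x)
  have e: "det2 (velocity D (partner D p)) (velocity D p) = - det2 (velocity D p) (velocity D
    (partner D p))"
    by (rule det2_commute)
  \<comment> \<open>Transversality enters through \<open>pp(7)\<close>: with a zero determinant
    \<open>cw\<close> and \<open>ccw\<close> would coincide.\<close>
  show "cw D (ccw D x) = x" "ccw D (cw D x) = x" "opp_end (cw D x) = ccw D x"
    using pp(3,4,7) e by (auto simp: ccw_def cw_def opp_end_def x Let_def direction_def)
qed

lemma swap_inv_smoothing: "swap_inv (strand_ends D) (over_ends D) (smoothing D S)"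
  unfolding swap_inv_def
  by (auto simp: smoothing_def A_smoothing_def B_smoothing_def over_ends_def cw_ccw)

lemma pos_smoothing: "x \<in> strand_ends D \<Longrightarrow> pos D (fst (smoothing D S x)) = pos D (fst x)"
  by (simp add: smoothing_def A_smoothing_def B_smoothing_def cw_ccw)

lemma card_state_curves:
  "card (state_curves D S) = num_classes (strand_ends D) (state_step D S) + card (free_comps D)"
proof -
  have "state_rel D S \<subseteq> strand_ends D \<times> strand_ends D" by (simp add: state_rel_eq)
  then have "finite (strand_ends D // state_rel D S)"
    using finite_strand_ends by (rule finite_quotient[rotated])
  then show ?thesis
    using finite_comps unfolding state_curves_def free_comps_def[symmetric] num_classes_def
      state_rel_eq
    by (intro card_Plus) (simp_all add: free_comps_def)
qed

end

section \<open>Switching crossings\<close>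

lemma switch_simps [simp]:
  "comps (switch W D) = comps D" "curve (switch W D) = curve D"
    "classical (switch W D) = classical D"
  "pos (switch W D) = pos D" "velocity (switch W D) = velocity D"
    "preimages (switch W D) = preimages D"
  "double_points (switch W D) = double_points D" "passages (switch W D) = passages D"
  "partner (switch W D) = partner D" "strand_ends (switch W D) = strand_ends D"
  "arc_end (switch W D) = arc_end D" "cw (switch W D) = cw D" "ccw (switch W D) = ccw D"
proof -
  show a: "comps (switch W D) = comps D" "curve (switch W D) = curve D"
    "classical (switch W D) = classical D"
    by (simp_all add: switch_def)
  then show b: "pos (switch W D) = pos D" "velocity (switch W D) = velocity D"
    by (intro ext; simp add: pos_def velocity_def)+
  then show c: "preimages (switch W D) = preimages D"
    using a by (intro ext) (simp add: preimages_def)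
  then show "double_points (switch W D) = double_points D" by (simp add: double_points_def)
  show d: "passages (switch W D) = passages D" using a c by (simp add: passages_def)
  show e: "partner (switch W D) = partner D" using b c by (intro ext) (simp add: partner_def)
  show "strand_ends (switch W D) = strand_ends D" using d by (simp add: strand_ends_def)
  show "arc_end (switch W D) = arc_end D"
    using d by (intro ext) (simp add: arc_end_def next_passage_def prev_passage_def)
  show "cw (switch W D) = cw D" "ccw (switch W D) = ccw D"
    using b e by (intro ext; simp add: cw_def ccw_def direction_def)+
qed

lemma over_switch:
  "over (switch W D) = {p \<in> passages D. if pos D p \<in> W then p \<notin> over D else p \<in> over D}"
  by (simp add: switch_def)

context link_diagram
begin

lemma virtual_link_diagram_switch: "virtual_link_diagram (switch W D)"
proof -
  have "\<forall>z\<in>classical D. \<exists>!p. p \<in> preimages D z \<and> p \<in> over (switch W D)"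
  proof
    fix z assume z: "z \<in> classical D"
    obtain p where p: "p \<in> preimages D z" "p \<in> over D" using bspec[OF ex1_over z] by blast
    then have "p \<in> passages D" "pos D p = z" using over_subset by (auto simp: preimages_def)
    note pp = passage_partner[OF this(1)] and pz = this(2)
    have "preimages D z = {p, partner D p}" using pp(8) pz by simp
    moreover have "p \<in> over (switch W D) \<longleftrightarrow> z \<notin> W"
      using p(2) over_subset pz unfolding over_switch by auto
    moreover have "partner D p \<in> over (switch W D) \<longleftrightarrow> z \<in> W"
      using p(2) pp(2,5,6) pz unfolding over_switch by auto
    ultimately show "\<exists>!p. p \<in> preimages D z \<and> p \<in> over (switch W D)" using pp(3)
      by (intro ex1I[of _ "if z \<in> W then partner D p else p"]) (auto split: if_splits)
  qed
  moreover have "over (switch W D) \<subseteq> passages D" by (auto simp: over_switch)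
  ultimately show ?thesis
    using diagram unfolding virtual_link_diagram_def switch_simps passages_def[symmetric]
    by (elim conjE) (intro conjI; assumption)
qed

lemma state_curves_switch:
  "state_curves (switch W D) S = state_curves D (sym_diff S W)"
proof -
  have "smoothing (switch W D) S x = smoothing D (sym_diff S W) x" if "x \<in> strand_ends D" for x
    using that by (auto simp: smoothing_def A_smoothing_def B_smoothing_def over_switch
      fst_strand_end)
  then have "state_step (switch W D) S = state_step D (sym_diff S W)"
    unfolding step_rel_def by auto
  then show ?thesis unfolding state_curves_def state_rel_eq by simp
qed

end

text \<open>Maps with the same fibres have images in bijection. This compares orbits of the boundary
  walk with curves of a state, which are sets of a different nature.\<close>

lemma card_image_eq_card_image:
  assumes "\<And>x y. x \<in> A \<Longrightarrow> y \<in> A \<Longrightarrow> f x = f y \<longleftrightarrow> g x = g y"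
  shows "card (f ` A) = card (g ` A)"
proof -
  have "g (inv_into A f (f x)) = g x" if "x \<in> A" for x
    using assms[of "inv_into A f (f x)" x] that by (simp add: f_inv_into_f inv_into_into)
  moreover have "f (inv_into A g (g x)) = f x" if "x \<in> A" for x
    using assms[of "inv_into A g (g x)" x] that by (simp add: f_inv_into_f inv_into_into)
  ultimately have "bij_betw (\<lambda>u. g (inv_into A f u)) (f ` A) (g ` A)"
    by (intro bij_betw_byWitness[where f' = "\<lambda>u. f (inv_into A g u)"]) auto
  then show ?thesis by (rule bij_betw_same_card)
qed

section \<open>Boundary components and states\<close>

text \<open>\<open>D\<close> is here the diagram after switching. The signs stay arbitrary because
  the surface does not depend on them.\<close>

locale alternating_link_diagram = link_diagram +
  fixes eps :: "complex \<Rightarrow> int"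
  assumes alternating: "alternating D"
begin

abbreviation "G \<equiv> alternating_ribbon_graph D eps"
abbreviation "X \<equiv> strand_ends D"
abbreviation "sub F \<equiv> spanning_ribbon_subgraph G F"

definition sub_ends :: "complex set \<Rightarrow> 'a strand_end set" where
  "sub_ends F = {x \<in> over_ends D. pos D (fst x) \<in> F}"

definition curve_of :: "complex set \<Rightarrow> 'a strand_end \<Rightarrow> 'a strand_end set" where
  "curve_of S x = state_rel D S `` {x}"

text \<open>Alternation enters here: consecutive passages differ in height, so every arc joins an
  over-end to an under-end.\<close>

lemma swap_inv_arc_end: "swap_inv X (over_ends D) (arc_end D)"
proof -
  have "fst (arc_end D x) \<in> over D \<longleftrightarrow> fst x \<notin> over D" if "x \<in> X" for x
    using alternating next_prev_passage[OF fst_strand_end[OF that]] fst_strand_end[OF that]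
    unfolding alternating_def arc_end_def by (metis fst_conv)
  then show ?thesis unfolding swap_inv_def by (simp add: over_ends_def arc_end)
qed

lemmas arc_simps = swap_invD[OF swap_inv_arc_end]
lemmas smoothing_simps = swap_invD[OF swap_inv_smoothing]

lemma equiv_state_rel: "equiv X (state_rel D S)"
  unfolding state_rel_eq
  by (rule equiv_rtrancl_Int[OF sym_step_rel[OF swap_inv_arc_end swap_inv_smoothing]])

lemma over_endsD: "x \<in> over_ends D \<Longrightarrow> x \<in> X" "x \<in> over_ends D \<Longrightarrow> fst x \<in> over D"
  by (simp_all add: over_ends_def)

lemma sub_ends_subset: "sub_ends F \<subseteq> over_ends D"
  by (auto simp: sub_ends_def)

lemma G_simps [simp]:
  "verts G = state_curves D {}" "edges G = classical D" "ends G = over_ends D"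
  "end_vert G = (\<lambda>x. Inl (curve_of {} x))" "end_edge G = (\<lambda>x. pos D (fst x))"
  "rot G = (\<lambda>x. cw D (arc_end D x))" "edge_sign G = eps"
  by (simp_all add: alternating_ribbon_graph_def over_ends_def curve_of_def)

lemma sub_simps [simp]:
  "verts (sub F) = verts G" "edges (sub F) = F" "ends (sub F) = sub_ends F"
  "end_vert (sub F) = end_vert G" "end_edge (sub F) = end_edge G" "edge_sign (sub F) = eps"
  by (simp_all add: spanning_ribbon_subgraph_def spanning_subgraph_def sub_ends_def)

section \<open>Ribbon ends and the boundary walk of a spanning subgraph\<close>

lemma over_ends_at_crossing:
  assumes "x \<in> over_ends D" "y \<in> over_ends D" "pos D (fst x) = pos D (fst y)"
  shows "y = x \<or> y = opp_end x"
proof -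
  have x: "fst x \<in> passages D" "fst x \<in> over D" and y: "fst y \<in> passages D" "fst y \<in> over D"
    using assms fst_strand_end over_endsD by blast+
  have "fst y \<in> preimages D (pos D (fst y))" using passage_partner(8)[OF y(1)] by blast
  then have "fst y \<in> {fst x, partner D (fst x)}"
    unfolding assms(3)[symmetric] using passage_partner(8)[OF x(1)] by simp
  moreover have "fst y \<noteq> partner D (fst x)" using passage_partner(6)[OF x(1)] x y by auto
  ultimately show ?thesis by (auto simp: opp_end_def prod_eq_iff)
qed

lemma opp_end_sub_ends: "x \<in> sub_ends F \<Longrightarrow> opp_end x \<in> sub_ends F"
  by (auto simp: sub_ends_def over_ends_def cw_ccw)

lemma opposite_end_sub:
  assumes "x \<in> sub_ends F"
  shows "opposite_end (sub F) x = opp_end x"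
  unfolding opposite_end_def
proof (rule the_equality)
  show "opp_end x \<in> ends (sub F) \<and> opp_end x \<noteq> x \<and> end_edge (sub F) (opp_end x) =
    end_edge (sub F) x"
    using opp_end_sub_ends[OF assms] by simp
  show "y = opp_end x" if "y \<in> ends (sub F) \<and> y \<noteq> x \<and> end_edge (sub F) y = end_edge (sub F) x" for y
    using that over_ends_at_crossing[of x y] assms sub_ends_subset by auto
qed

text \<open>The arc from an over-end arrives at an under-end, where the B-splitting turns clockwise,
  as \<open>rot\<close> does, and the A-splitting counterclockwise, into the end opposite to that
  one. This is the form demanded of \<open>p\<close> in
  \<open>first_return_orbit_iff\<close>.\<close>

lemma smoothing_arc_end:
  assumes "x \<in> over_ends D"
  shows "(smoothing D F \<circ> arc_end D) x =
    (if cw D (arc_end D x) \<in> sub_ends F then opp_end (cw D (arc_end D x)) else cw D (arc_end D x))"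
proof -
  have y: "arc_end D x \<in> X" "fst (arc_end D x) \<notin> over D"
    using arc_simps[of x] assms by (auto simp: over_ends_def)
  then show ?thesis
    by (auto simp: smoothing_def A_smoothing_def B_smoothing_def sub_ends_def over_ends_def cw_ccw)
qed

lemma rot_over_ends: "x \<in> over_ends D \<Longrightarrow> cw D (arc_end D x) \<in> over_ends D"
  using arc_simps[of x] cw_ccw[of "arc_end D x"] by (auto simp: over_ends_def)

lemma rot_sub:
  assumes "x \<in> sub_ends F"
  shows "rot (sub F) x = (rot G ^^ (LEAST n. 0 < n \<and> (rot G ^^ n) x \<in> sub_ends F)) x"
proof -
  have "(rot G ^^ n) x \<in> over_ends D" for n
    by (induction n) (use assms sub_ends_subset rot_over_ends in auto)
  then have "end_edge G ((rot G ^^ n) x) \<in> F \<longleftrightarrow> (rot G ^^ n) x \<in> sub_ends F" for n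
    unfolding sub_ends_def by simp
  then show ?thesis unfolding spanning_ribbon_subgraph_def by simp
qed

lemma curve_of_eq_iff:
  assumes "x \<in> X" "y \<in> X"
  shows "curve_of S x = curve_of S y \<longleftrightarrow> (x, y) \<in> (state_step D S)\<^sup>*"
  using assms eq_equiv_class_iff[OF equiv_state_rel, of x y] unfolding curve_of_def
  by (simp add: state_rel_eq)

text \<open>The boundary walk leaves the opposite end of \<open>y\<close> outwards, hence runs along the
  curve through \<open>opp_end y\<close>, and not the one through \<open>y\<close>.\<close>

lemma boundary_orbit_iff:
  assumes "y \<in> sub_ends F" "y' \<in> sub_ends F"
  shows "y' \<in> orbit (rot (sub F) \<circ> opposite_end (sub F)) y \<longleftrightarrow>
    curve_of F (opp_end y) = curve_of F (opp_end y')"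
proof -
  let ?p = "smoothing D F \<circ> arc_end D"
  have XH: "X \<inter> over_ends D = over_ends D" using over_endsD by blast
  have fin: "finite (over_ends D)" using finite_strand_ends by (simp add: over_ends_def)
  have B: "(smoothing D {} \<circ> arc_end D) x = cw D (arc_end D x)" if "x \<in> over_ends D" for x
    using smoothing_arc_end[OF that] by (simp add: sub_ends_def)
  \<comment> \<open>The rotation is the curve step of the all-B state, a composition of two
    involutions.\<close>
  have inj: "inj_on (rot G) (over_ends D)"
    using swap_inv_comp(1)[OF swap_inv_arc_end swap_inv_smoothing[of "{}"]] B unfolding XH G_simps
    by (metis (no_types, lifting) inj_on_cong)
  have opp: "opposite_end (sub F) x \<in> sub_ends F \<and> opposite_end (sub F) (opposite_end (sub F) x) =
    x"
    if "x \<in> sub_ends F" for x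
    using opposite_end_sub opp_end_sub_ends that by simp
  have "curve_of F (opp_end y) = curve_of F (opp_end y') \<longleftrightarrow> opp_end y' \<in> orbit ?p (opp_end y)"
    using rtrancl_step_rel_iff_orbit[OF swap_inv_arc_end swap_inv_smoothing finite_strand_ends,
        of "opp_end y" "opp_end y'" F] curve_of_eq_iff[of "opp_end y" "opp_end y'" F]
      assms opp_end_sub_ends sub_ends_subset over_endsD unfolding XH by blast
  also have "\<dots> \<longleftrightarrow> opposite_end (sub F) y' \<in> orbit ?p (opposite_end (sub F) y)"
    by (simp add: assms opposite_end_sub)
  also have "\<dots> \<longleftrightarrow> y' \<in> orbit (rot (sub F) \<circ> opposite_end (sub F)) y"
  proof (rule first_return_orbit_iff[where H = "over_ends D" and Y = "sub_ends F" and r = "rot G"])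
    show "rot G ` over_ends D \<subseteq> over_ends D" using rot_over_ends by auto
    show "?p h = (if rot G h \<in> sub_ends F then opposite_end (sub F) (rot G h) else rot G h)"
      if "h \<in> over_ends D" for h
      unfolding smoothing_arc_end[OF that] by (simp add: opposite_end_sub)
  qed (use fin inj opp assms sub_ends_subset rot_sub in blast)+
  finally show ?thesis by simp
qed

text \<open>The shift by \<open>opp_end\<close> in \<open>boundary_orbit_iff\<close> does not affect
  the count, since \<open>opp_end\<close> permutes \<open>sub_ends F\<close>.\<close>

lemma card_boundary_orbits:
  "card (orbit (rot (sub F) \<circ> opposite_end (sub F)) ` sub_ends F) = card (curve_of F ` sub_ends F)"
proof -
  let ?\<phi> = "rot (sub F) \<circ> opposite_end (sub F)"
  have "orbit ?\<phi> x = orbit ?\<phi> y \<longleftrightarrow> curve_of F (opp_end x) = curve_of F (opp_end y)"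
    if x: "x \<in> sub_ends F" and y: "y \<in> sub_ends F" for x y
  proof -
    have "x \<in> orbit ?\<phi> x" "y \<in> orbit ?\<phi> y" using boundary_orbit_iff x y by blast+
    then have "orbit ?\<phi> x = orbit ?\<phi> y \<longleftrightarrow> y \<in> orbit ?\<phi> x"
      by (auto intro: orbit_swap orbit_trans)
    then show ?thesis using boundary_orbit_iff[OF x y] by simp
  qed
  then have "card (orbit ?\<phi> ` sub_ends F) = card ((\<lambda>x. curve_of F (opp_end x)) ` sub_ends F)"
    by (rule card_image_eq_card_image)
  also have "(\<lambda>x. curve_of F (opp_end x)) ` sub_ends F = curve_of F ` (opp_end ` sub_ends F)"
    by (simp add: image_image)
  also have "opp_end ` sub_ends F = sub_ends F"
    using opp_end_sub_ends opp_end_opp_end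
      by (metis (no_types, lifting) image_eqI image_subsetI subsetI subset_antisym)
  finally show ?thesis .
qed

text \<open>Of two ends joined by a smoothing one is an over-end. So a curve without over-ends at
  the crossings in \<open>F\<close> passes through none of them, and changing the splittings there
  leaves it intact.\<close>

lemma curves_off_crossings:
  assumes C: "C \<in> X // state_rel D S" "C \<inter> sub_ends F = {}" and SS': "S - F = S' - F"
  shows "C \<in> X // state_rel D S'"
proof -
  obtain x where x: "x \<in> X" "C = state_rel D S `` {x}" using C(1) by (auto elim: quotientE)
  have mem: "y \<in> C \<longleftrightarrow> y \<in> X \<and> (x, y) \<in> (state_step D S)\<^sup>*" for y
    using x by (simp add: state_rel_eq) blast
  have closed: "arc_end D y \<in> C" "smoothing D S y \<in> C" if "y \<in> C" for y
    using that arc_simps[of y] smoothing_simps[of y S]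
      in_step_rel[of y X "arc_end D" "smoothing D S"]
      in_step_rel(2)[of y X "smoothing D S" "arc_end D"] unfolding mem
    by (auto intro: rtrancl_into_rtrancl)
  have same: "smoothing D S' y = smoothing D S y" if "y \<in> C" for y
  proof -
    have "y \<in> X" using that mem by blast
    have "pos D (fst y) \<notin> F"
    proof
      assume "pos D (fst y) \<in> F"
      then have "y \<in> sub_ends F \<or> smoothing D S y \<in> sub_ends F"
        using smoothing_simps[OF \<open>y \<in> X\<close>, of S] pos_smoothing[OF \<open>y \<in> X\<close>, of S] \<open>y \<in> X\<close>
        by (auto simp: sub_ends_def over_ends_def)
      then show False using C(2) closed that by blast
    qed
    then show ?thesis using SS' unfolding smoothing_def by (metis DiffI DiffD1)
  qed
  have "y \<in> C \<longleftrightarrow> y \<in> X \<and> (x, y) \<in> (state_step D S')\<^sup>*" for y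
  proof
    have "(x, y) \<in> (state_step D S')\<^sup>* \<and> y \<in> C" if "(x, y) \<in> (state_step D S)\<^sup>*" for y
      using that
    proof induction
      case base
      then show ?case using x mem by simp
    next
      case (step y z)
      then have y: "y \<in> C" "y \<in> X" "z = arc_end D y \<or> z = smoothing D S' y"
        using same mem unfolding step_rel_def by auto
      then have "(y, z) \<in> state_step D S'"
        using in_step_rel[of y X "arc_end D" "smoothing D S'"]
          in_step_rel(2)[of y X "smoothing D S'" "arc_end D"]
        by auto
      moreover have "z \<in> C" using y closed[of y] same[of y] by auto
      ultimately show ?case using step.IH by (blast intro: rtrancl_into_rtrancl)
    qed
    then show "y \<in> X \<and> (x, y) \<in> (state_step D S')\<^sup>*" if "y \<in> C" using that mem by blast
    show "y \<in> C" if "y \<in> X \<and> (x, y) \<in> (state_step D S')\<^sup>*"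
    proof -
      from that have "(x, y) \<in> (state_step D S')\<^sup>*" by blast
      then show "y \<in> C"
      proof induction
        case base
        then show ?case using x mem by simp
      next
        case (step y z)
        then have "z = arc_end D y \<or> z = smoothing D S' y" by (auto simp: step_rel_def)
        then show ?case using same[of y] closed[of y] step.IH by auto
      qed
    qed
  qed
  then have "C = state_rel D S' `` {x}" using x by (auto simp: state_rel_eq)
  then show ?thesis using x(1) by (simp add: quotientI)
qed

text \<open>On the right are the exterior circles of vertices that meet no ribbon of
  \<open>F\<close>; such a circle is its own boundary component and survives as a curve of the state
  \<open>F\<close>.\<close>

lemma curves_off_crossings_eq:
  "X // state_rel D F - curve_of F ` sub_ends F = X // state_rel D {} - curve_of {} ` sub_ends F"
proof -
  have *: "X // state_rel D S - curve_of S ` sub_ends F = {C \<in> X // state_rel D S. C \<inter> sub_ends F =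
    {}}" for S
  proof (intro equalityI subsetI)
    fix C assume C: "C \<in> X // state_rel D S - curve_of S ` sub_ends F"
    then obtain x where x: "C = state_rel D S `` {x}" by (auto elim: quotientE)
    have "curve_of S y = C" if "y \<in> C" for y
      unfolding x curve_of_def using equiv_class_eq[OF equiv_state_rel] that x
        by (metis Image_singleton_iff)
    then show "C \<in> {C \<in> X // state_rel D S. C \<inter> sub_ends F = {}}" using C by blast
  next
    fix C assume C: "C \<in> {C \<in> X // state_rel D S. C \<inter> sub_ends F = {}}"
    have "y \<in> curve_of S y" if "y \<in> sub_ends F" for y
      using equiv_class_self[OF equiv_state_rel] that sub_ends_subset over_endsD
        unfolding curve_of_def by blast
    then show "C \<in> X // state_rel D S - curve_of S ` sub_ends F" using C by blast
  qed
  show ?thesis unfolding * using curves_off_crossings[of _ F F "{}"] curves_off_crossings[of _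
    "{}" F F] by blast
qed

text \<open>Cycles of the boundary walk account for the curves through crossings in
  \<open>F\<close>; isolated vertices account for the other curves and for the components without
  classical crossings.\<close>

lemma num_bdry_sub: "num_bdry (sub F) = int (card (state_curves D F))"
proof -
  have finX: "finite (X // state_rel D S)" for S
    by (rule finite_quotient[OF finite_strand_ends]) (simp add: state_rel_eq)
  have fin: "finite (free_comps D)" using finite_comps by (simp add: free_comps_def)
  have sub: "curve_of S ` sub_ends F \<subseteq> X // state_rel D S" for S
    using sub_ends_subset over_endsD unfolding curve_of_def by (blast intro: quotientI)
  let ?Q = "X // state_rel D F - curve_of F ` sub_ends F"
  have "card (state_curves D F) = card (X // state_rel D F) + card (free_comps D)"
    unfolding state_curves_def free_comps_def[symmetric] using finX fin by (rule card_Plus)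
  also have "card (X // state_rel D F) = card (curve_of F ` sub_ends F) + card ?Q"
    using card_Diff_subset[OF finite_subset[OF sub finX] sub] card_mono[OF finX sub]
      by (metis le_add_diff_inverse)
  finally have 1: "card (state_curves D F) = card (curve_of F ` sub_ends F) + card ?Q + card
    (free_comps D)" .
  have "verts (sub F) - end_vert (sub F) ` ends (sub F) =
      (X // state_rel D {} - curve_of {} ` sub_ends F) <+> free_comps D"
    by (auto simp: state_curves_def free_comps_def)
  then have "card (verts (sub F) - end_vert (sub F) ` ends (sub F)) = card ?Q + card (free_comps D)"
    unfolding curves_off_crossings_eq using finX fin by (simp add: card_Plus)
  then show ?thesis
    unfolding num_bdry_def 1 sub_simps(3) card_boundary_orbits by simp
qed

end

lemma increasing_on_subsets:
  fixes f :: "'a set \<Rightarrow> int"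
  assumes "finite E" "A \<subseteq> B" "B \<subseteq> E"
    and step: "\<And>F z. F \<subseteq> E \<Longrightarrow> z \<in> E - F \<Longrightarrow> f F \<le> f (insert z F)"
  shows "f A \<le> f B"
proof -
  have "f A \<le> f (A \<union> C)" if "finite C" "C \<subseteq> E - A" for C
    using that
  proof (induction C)
    case empty
    then show ?case by simp
  next
    case (insert z C)
    then have "f (A \<union> C) \<le> f (insert z (A \<union> C))" using assms(2,3) by (intro step) auto
    then show ?case using insert by simp
  qed
  moreover have "finite (B - A)" "B - A \<subseteq> E - A" "A \<union> (B - A) = B"
    using assms(1-3) finite_subset by blast+
  ultimately show ?thesis by metis
qed

section \<open>Monotonicity of nullity and genus\<close>

context alternating_link_diagram
begin

definition edge_rel :: "complex set \<Rightarrow> (('a strand_end set + 'a) \<times> ('a strand_end set + 'a)) set"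
  where
  "edge_rel F = {(end_vert G h, end_vert G h') | h h'.
     h \<in> sub_ends F \<and> h' \<in> sub_ends F \<and> pos D (fst h) = pos D (fst h')}"

lemma num_comps_sub: "num_comps (sub F) = int (num_classes (verts G) (edge_rel F))"
  unfolding num_comps_def connected_rel_def num_classes_def edge_rel_def by simp

lemma sym_edge_rel: "sym (edge_rel F)"
proof (rule symI)
  fix u v assume "(u, v) \<in> edge_rel F"
  then obtain h h' where "u = end_vert G h" "v = end_vert G h'" "h \<in> sub_ends F" "h' \<in> sub_ends F"
    "pos D (fst h) = pos D (fst h')"
    unfolding edge_rel_def by blast
  then show "(v, u) \<in> edge_rel F"
    unfolding edge_rel_def mem_Collect_eq by (intro exI[of _ h'] exI[of _ h]) simp
qed

lemma finite_verts: "finite (verts G)"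
proof -
  have "finite (X // state_rel D {})"
    by (rule finite_quotient[OF finite_strand_ends]) (simp add: state_rel_eq)
  then show ?thesis using finite_comps by (simp add: state_curves_def)
qed

lemma end_vert_in_verts: "x \<in> X \<Longrightarrow> end_vert G x \<in> verts G"
  by (auto simp: state_curves_def curve_of_def intro: quotientI)

lemma ex_over_end:
  assumes "z \<in> classical D"
  obtains x where "x \<in> over_ends D" "pos D (fst x) = z"
proof -
  obtain p where p: "p \<in> preimages D z" "p \<in> over D" using bspec[OF ex1_over assms] by blast
  then have "(p, True) \<in> over_ends D"
    using over_subset by (auto simp: over_ends_def strand_ends_def)
  moreover have "pos D (fst (p, True)) = z" using p by (simp add: preimages_def)
  ultimately show ?thesis by (rule that)
qed

text \<open>An under-end is joined in the all-B state to an over-end of the same crossing, so it too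
  lies on the exterior circle of a vertex to which the ribbon is attached.\<close>

lemma same_crossing_edge:
  assumes "x \<in> X" "y \<in> X" "pos D (fst x) = pos D (fst y)" "pos D (fst x) \<in> F"
  shows "(end_vert G x, end_vert G y) \<in> edge_rel F"
proof -
  have *: "\<exists>x'\<in>sub_ends F. end_vert G x' = end_vert G x \<and> pos D (fst x') = pos D (fst x)"
    if x: "x \<in> X" "pos D (fst x) \<in> F" for x
  proof (cases "x \<in> over_ends D")
    case True
    then show ?thesis using x by (intro bexI[of _ x]) (simp_all add: sub_ends_def)
  next
    case False
    let ?x = "smoothing D {} x"
    have "?x \<in> sub_ends F" using False x smoothing_simps[of x]
      by (simp add: sub_ends_def pos_smoothing)
    moreover have "curve_of {} x = curve_of {} ?x"
      unfolding curve_of_eq_iff[OF x(1) smoothing_simps(1)[OF x(1)]]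
      by (rule r_into_rtrancl[OF in_step_rel(2)[OF x(1)]])
    ultimately show ?thesis using pos_smoothing[OF x(1)] by (intro bexI[of _ ?x]) simp_all
  qed
  obtain x' where x': "x' \<in> sub_ends F" "end_vert G x' = end_vert G x"
    "pos D (fst x') = pos D (fst x)"
    using *[of x] assms by blast
  obtain y' where y': "y' \<in> sub_ends F" "end_vert G y' = end_vert G y"
    "pos D (fst y') = pos D (fst y)"
    using *[OF assms(2)] assms(3,4) by auto
  show ?thesis unfolding edge_rel_def mem_Collect_eq
    by (intro exI[of _ x'] exI[of _ y']) (use x' y' assms(3) in simp)
qed

text \<open>A boundary curve stays within one component of the subgraph: a step shared with the
  all-B state remains at the same vertex, and any other step runs along a ribbon of
  \<open>F\<close>.\<close>

lemma state_curve_connected: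
  assumes "(x, y) \<in> (state_step D F)\<^sup>*"
  shows "(end_vert G x, end_vert G y) \<in> (edge_rel F)\<^sup>*"
  using assms
proof induction
  case base
  then show ?case by simp
next
  case (step y z)
  have y: "y \<in> X" and z: "z = arc_end D y \<or> z = smoothing D F y"
    using step.hyps(2) by (auto simp: step_rel_def)
  have zX: "z \<in> X" using y z arc_simps smoothing_simps by blast
  show ?case
  proof (cases "(y, z) \<in> state_step D {}")
    case True
    then have "end_vert G y = end_vert G z" using y zX by (simp add: curve_of_eq_iff)
    then show ?thesis using step.IH by simp
  next
    case False
    have "z \<noteq> arc_end D y" "z \<noteq> smoothing D {} y"
      using False in_step_rel(1)[OF y, of "arc_end D"] in_step_rel(2)[OF y, of "smoothing D {}"]
        by blast+
    then have zF: "z = smoothing D F y" "smoothing D F y \<noteq> smoothing D {} y" using z by blast+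
    then have "pos D (fst y) \<in> F" unfolding smoothing_def by (metis empty_iff)
    moreover have "pos D (fst z) = pos D (fst y)" using zF pos_smoothing[OF y] by simp
    ultimately have "(end_vert G y, end_vert G z) \<in> edge_rel F" using same_crossing_edge[OF y zX]
      by simp
    then show ?thesis using step.IH by (rule rtrancl_into_rtrancl[rotated])
  qed
qed

text \<open>The last inequality says that twice the genus, \<open>2 k - v + e - bc\<close>, does not
  decrease; the summand 1 is the new edge. If the ribbon joins vertices of one component,
  \<open>k\<close> stays and \<open>bc\<close> grows by at most one. Otherwise \<open>k\<close>
  drops by at most one, but the curves at the two ends of the ribbon lie in different components,
  hence differ, and \<open>bc\<close> drops as well.\<close>

lemma insert_crossing:
  assumes z: "z \<in> classical D" "z \<notin> F"
  shows "num_comps (sub (insert z F)) \<le> num_comps (sub F)"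
    and "num_comps (sub F) \<le> num_comps (sub (insert z F)) + 1"
    and "2 * num_comps (sub F) - num_bdry (sub F)
      \<le> 2 * num_comps (sub (insert z F)) + 1 - num_bdry (sub (insert z F))"
proof -
  obtain x1 where x1: "x1 \<in> over_ends D" "pos D (fst x1) = z" using ex_over_end[OF z(1)] .
  define x2 where "x2 = opp_end x1"
  have x2: "x2 \<in> over_ends D" "pos D (fst x2) = z" "x1 \<noteq> x2"
    using x1 opp_end_neq[of x1, symmetric] cw_ccw(3)[of x1] by (simp_all add: x2_def over_ends_def)
  have at_z: "x = x1 \<or> x = x2" if "x \<in> over_ends D" "pos D (fst x) = z" for x
    using over_ends_at_crossing[of x1 x] that x1 by (simp add: x2_def)
  let ?F = "insert z F" and ?v1 = "end_vert G x1" and ?v2 = "end_vert G x2"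
  let ?E = "edge_rel F" and ?E' = "edge_rel (insert z F)"
  let ?P = "?E \<union> {(?v1, ?v2), (?v2, ?v1)}"
  have V: "?v1 \<in> verts G" "?v2 \<in> verts G" using end_vert_in_verts x1 x2 over_endsD by blast+
  have EE': "?E \<subseteq> ?E'" unfolding edge_rel_def sub_ends_def by blast
  have E'P: "?E' \<subseteq> ?P\<^sup>*"
  proof
    fix e assume "e \<in> ?E'"
    then obtain h h' where h: "e = (end_vert G h, end_vert G h')" "h \<in> sub_ends ?F"
      "h' \<in> sub_ends ?F"
      "pos D (fst h) = pos D (fst h')" unfolding edge_rel_def by blast
    show "e \<in> ?P\<^sup>*"
    proof (cases "pos D (fst h) = z")
      case True
      then have "h \<in> {x1, x2}" "h' \<in> {x1, x2}" using at_z[of h] at_z[of h'] h sub_ends_subset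
        by auto
      then show ?thesis unfolding h(1) by auto
    next
      case False
      then have "h \<in> sub_ends F" "h' \<in> sub_ends F" using h by (auto simp: sub_ends_def)
      then show ?thesis using h unfolding edge_rel_def by blast
    qed
  qed
  have symP: "sym ?P" using sym_edge_rel[of F] unfolding sym_def by blast
  have k: "num_classes (verts G) ?E' \<le> num_classes (verts G) ?E"
    using EE' by (intro num_classes_antimono finite_verts sym_edge_rel) auto
  have "num_classes (verts G) ?E \<le> Suc (num_classes (verts G) ?P)"
    by (rule num_classes_insert_pair[OF finite_verts sym_edge_rel V(2)])
  also have "num_classes (verts G) ?P \<le> num_classes (verts G) ?E'"
    using E'P by (intro num_classes_antimono finite_verts sym_edge_rel symP)
  finally have k1: "num_classes (verts G) ?E \<le> Suc (num_classes (verts G) ?E')" by simp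
  show "num_comps (sub ?F) \<le> num_comps (sub F)" "num_comps (sub F) \<le> num_comps (sub ?F) + 1"
    using k k1 by (simp_all add: num_comps_sub)
  have over: "fst x1 \<in> over D" "fst x2 \<in> over D" "x1 \<in> X" "x2 \<in> X"
    using x1 x2 over_endsD by blast+
  have sm: "smoothing D ?F x1 = smoothing D F x2" "smoothing D ?F x2 = smoothing D F x1"
    using z(2) x1 x2 over cw_opp_end[of D x1] ccw_opp_end[of D x1]
    by (simp_all add: smoothing_def A_smoothing_def B_smoothing_def flip: x2_def)
  have sm': "smoothing D ?F x = smoothing D F x"
    if x: "x \<in> X" "x \<notin> {x1, x2, smoothing D F x1, smoothing D F x2}" for x
  proof -
    have "pos D (fst x) \<noteq> z"
    proof
      assume xz: "pos D (fst x) = z"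
      then have "x \<notin> over_ends D" using at_z x by blast
      then have "smoothing D F x \<in> {x1, x2}"
        using at_z[of "smoothing D F x"] smoothing_simps(3)[OF x(1)] pos_smoothing[OF x(1)] xz
          by auto
      then show False using x smoothing_simps(2)[OF x(1), of F] by auto
    qed
    then show ?thesis by (simp add: smoothing_def)
  qed
  have x12: "x1 \<in> X \<inter> over_ends D" "x2 \<in> X \<inter> over_ends D" using x1 x2 over by blast+
  note c = num_classes_reconnect[OF finite_strand_ends swap_inv_arc_end swap_inv_smoothing
      swap_inv_smoothing x12 x2(3) sm sm']
  have c1: "num_classes X (state_step D ?F) \<le> Suc (num_classes X (state_step D F))"
    using c(1) by blast
  have "2 * num_classes (verts G) ?E + num_classes X (state_step D ?F)
      \<le> 2 * num_classes (verts G) ?E' + 1 + num_classes X (state_step D F)"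
  proof (cases "(?v1, ?v2) \<in> ?E\<^sup>*")
    case True
    then have "?P \<subseteq> ?E\<^sup>*" using sym_rtrancl[OF sym_edge_rel[of F]] by (auto dest: symD)
    then have "?E' \<subseteq> ?E\<^sup>*" using E'P rtrancl_subset_rtrancl by blast
    then have "num_classes (verts G) ?E \<le> num_classes (verts G) ?E'"
      by (intro num_classes_antimono finite_verts sym_edge_rel)
    then show ?thesis using c1 by linarith
  next
    case False
    then have "(x1, x2) \<notin> (state_step D F)\<^sup>*" using state_curve_connected by blast
    then have "num_classes X (state_step D ?F) < num_classes X (state_step D F)" using c(2) by blast
    then show ?thesis using k1 by linarith
  qed
  then show "2 * num_comps (sub F) - num_bdry (sub F)
      \<le> 2 * num_comps (sub ?F) + 1 - num_bdry (sub ?F)"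
    by (simp add: num_comps_sub num_bdry_sub card_state_curves)
qed

section \<open>The two extreme subgraphs: without ribbons and with all of them\<close>

lemma num_comps_sub_empty: "num_comps (sub {}) = num_verts G"
proof -
  have "(edge_rel {})\<^sup>* \<inter> verts G \<times> verts G = Id_on (verts G)"
    by (auto simp: edge_rel_def sub_ends_def)
  moreover have "verts G // Id_on (verts G) = (\<lambda>v. {v}) ` verts G"
    by (auto simp: quotient_def)
  ultimately show ?thesis
    unfolding num_comps_sub num_classes_def num_verts_def by (simp add: card_image inj_on_def)
qed

lemma num_verts_edges_sub:
  "num_verts (sub F) = num_verts G" "num_edges (sub F) = int (card F)"
  by (simp_all add: num_verts_def num_edges_def)

lemma num_comps_sub_classical: "num_comps (sub (classical D)) = num_comps G"
proof -
  have "sub_ends (classical D) = over_ends D"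
    using passage_partner(1) fst_strand_end by (auto simp: sub_ends_def over_ends_def)
  then show ?thesis by (simp add: num_comps_def connected_rel_def)
qed

text \<open>The rotation of the full subgraph is given as a first return; on the ends of
  \<open>G\<close> this return takes one step.\<close>

lemma num_bdry_sub_classical: "num_bdry (sub (classical D)) = num_bdry G"
proof -
  let ?H = "sub (classical D)"
  have Y: "sub_ends (classical D) = over_ends D"
    using passage_partner(1) fst_strand_end by (auto simp: sub_ends_def over_ends_def)
  have opp: "opposite_end ?H = opposite_end G" by (simp add: opposite_end_def fun_eq_iff Y)
  have rot: "rot ?H x = rot G x" if "x \<in> over_ends D" for x
  proof -
    have "(LEAST n. 0 < n \<and> (rot G ^^ n) x \<in> over_ends D) = 1"
      using rot_over_ends[OF that] by (intro Least_equality) auto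
    then show ?thesis using rot_sub[of x "classical D"] that Y by simp
  qed
  have opp_in: "opposite_end G x \<in> over_ends D" if "x \<in> over_ends D" for x
    using opposite_end_sub[of x "classical D"] opp_end_sub_ends[of x "classical D"] that opp Y
      by simp
  have "orbit (rot G \<circ> opposite_end G) x = orbit (rot ?H \<circ> opposite_end ?H) x"
    if "x \<in> over_ends D" for x
    by (rule orbit_cong0[OF that]) (use opp_in rot rot_over_ends opp in auto)
  then have "orbit (rot G \<circ> opposite_end G) ` over_ends D = orbit (rot ?H \<circ> opposite_end ?H) `
    over_ends D"
    by (rule image_cong[OF refl])
  then show ?thesis unfolding num_bdry_def by (simp add: Y)
qed

lemma num_comps_sub_ge:
  assumes "F \<subseteq> classical D"
  shows "num_comps G \<le> num_comps (sub F)"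
proof -
  have "- num_comps (sub F) \<le> - num_comps (sub (classical D))"
    by (rule increasing_on_subsets[OF finite_classical assms order_refl])
      (use insert_crossing(1) in auto)
  then show ?thesis by (simp add: num_comps_sub_classical)
qed

lemma nullity_sub_nonneg:
  assumes "F \<subseteq> classical D"
  shows "0 \<le> graph_nullity (sub F)"
proof -
  have null: "graph_nullity (sub F) = int (card F) - num_verts G + num_comps (sub F)" for F
    by (simp add: graph_nullity_def graph_rank_def num_verts_edges_sub)
  have "graph_nullity (sub {}) \<le> graph_nullity (sub F)"
  proof (rule increasing_on_subsets[OF finite_classical empty_subsetI assms])
    fix F z assume "F \<subseteq> classical D" "z \<in> classical D - F"
    then show "graph_nullity (sub F) \<le> graph_nullity (sub (insert z F))"
      using insert_crossing(2)[of z F] finite_subset[OF _ finite_classical, of F] unfolding null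
        by simp
  qed
  then show ?thesis by (simp add: null num_comps_sub_empty)
qed

lemma planar_num_bdry_sub:
  assumes "F \<subseteq> classical D" "planar G"
  shows "num_comps (sub F) - num_bdry (sub F) + graph_nullity (sub F) = 0"
proof -
  \<comment> \<open>By the definition of nullity, this exponent of \<open>z\<close> is
    \<open>2 k - v + e - bc\<close>, twice the genus of the subgraph.\<close>
  define g where "g F = num_comps (sub F) - num_bdry (sub F) + graph_nullity (sub F)" for F
  have g: "g F = 2 * num_comps (sub F) - num_verts G + int (card F) - num_bdry (sub F)" for F
    unfolding g_def by (simp add: graph_nullity_def graph_rank_def num_verts_edges_sub)
  have "g F \<le> g (insert z F)" if "F \<subseteq> classical D" "z \<in> classical D - F" for F z
    using insert_crossing(3)[of z F] finite_subset[OF that(1) finite_classical] that unfolding g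
      by simp
  then have "g {} \<le> g F" "g F \<le> g (classical D)"
    using increasing_on_subsets[OF finite_classical, of _ _ g] assms(1) by blast+
  moreover have "g {} = 0"
    unfolding g num_comps_sub_empty by (simp add: num_bdry_sub num_verts_def)
  moreover have "g (classical D) = 0"
    using assms(2) unfolding g planar_def genus_def num_comps_sub_classical num_bdry_sub_classical
    by (simp add: num_edges_def)
  ultimately show ?thesis unfolding g_def by linarith
qed

text \<open>This settles the empty diagram, the one case in which the exponent
  \<open>num_comps G - 1\<close> is negative.\<close>

lemma no_comps_imp_no_crossings:
  assumes "num_comps G = 0"
  shows "verts G = {}" "classical D = {}"
proof -
  have "finite (verts G // connected_rel G)"
    by (rule finite_quotient[OF finite_verts]) (auto simp: connected_rel_def)
  then have "verts G // connected_rel G = {}" using assms by (simp add: num_comps_def)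
  then show "verts G = {}" by (simp add: quotient_def)
  then show "classical D = {}" using ex_over_end end_vert_in_verts over_endsD
    by (metis equals0D equals0I)
qed

end

section \<open>Comparison of the terms\<close>

text \<open>The two powers of \<open>d\<close> are kept apart because merging them needs conditions:
  \<open>d\<close> nonzero in one formula, signs of the exponents in the other.\<close>

lemma split_powi_factors:
  fixes a d :: "'a::field"
  assumes "a \<noteq> 0"
  shows "(a\<^sup>2 * d) powi m * (inverse (a\<^sup>2) * d) powi l = a powi (2 * m - 2 * l) *
    (d powi m * d powi l)"
proof -
  have "a powi (2 * m - 2 * l) = (a\<^sup>2) powi m * inverse ((a\<^sup>2) powi l)"
    using assms by (simp only: power_int_diff simp_thms power_int_power of_nat_numeral
      divide_inverse)
  then show ?thesis by (simp add: power_int_mult_distrib power_int_inverse mult_ac)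
qed

text \<open>The base of the power \<open>s\<close> is the square root \<open>a\<^sup>2\<close> of
  \<open>x / y = a^4\<close>, and \<open>s\<close> stands for \<open>twice_s\<close>.\<close>

lemma BR_term:
  fixes a d :: "'a::field"
  assumes "a \<noteq> 0" "d \<noteq> 0"
  shows "a powi e * d powi k *
      ((a\<^sup>2 * d) powi m * (inverse (a\<^sup>2) * d) powi l * (a\<^sup>2) powi s * (1 / d) powi j) =
    a powi (e + 2 * m - 2 * l + 2 * s) * d powi (k + m + l - j)"
proof -
  have "(1 / d) powi j = d powi (- j)"
    by (simp add: power_int_minus power_int_one_over inverse_eq_divide)
  then have "a powi e * d powi k *
      ((a\<^sup>2 * d) powi m * (inverse (a\<^sup>2) * d) powi l * (a\<^sup>2) powi s * (1 / d) powi j) =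
    (a powi e * a powi (2 * m - 2 * l) * a powi (2 * s)) * (d powi k * d powi m * d powi l * d powi
      (- j))"
    unfolding split_powi_factors[OF assms(1)] by (simp add: power_int_power)
  also have "\<dots> = a powi (e + (2 * m - 2 * l) + 2 * s) * d powi (k + m + l + (- j))"
    using assms by (simp only: power_int_add simp_thms)
  finally show ?thesis by (simp add: algebra_simps)
qed

text \<open>Since \<open>d\<close> may be \<open>0\<close> and \<open>0 powi k = 0\<close> for negative \<open>k\<close>, adding exponents needs
  the sign conditions.\<close>

lemma tutte_term:
  fixes a d :: "'a::field"
  assumes "a \<noteq> 0" "0 \<le> m" "0 \<le> l" "0 \<le> k \<or> m = 0 \<and> l = 0"
  shows "a powi e * d powi k * ((a\<^sup>2 * d) powi m * (inverse (a\<^sup>2) * d) powi l) =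
    a powi (e + 2 * m - 2 * l) * d powi (k + m + l)"
proof -
  have "d powi k * (d powi m * d powi l) = d powi (k + m + l)"
  proof (cases "m = 0 \<and> l = 0")
    case False
    then have "0 \<le> k" using assms(4) by blast
    then have "d powi (k + m + l) = d ^ (nat k + nat m + nat l)"
      using assms(2,3) by (simp add: power_int_def nat_add_distrib)
    then show ?thesis using assms(2,3) \<open>0 \<le> k\<close> by (simp add: power_int_def power_add)
  qed simp
  moreover have "a powi e * a powi (2 * m - 2 * l) = a powi (e + 2 * m - 2 * l)"
    using assms(1) by (simp flip: power_int_add add: algebra_simps)
  moreover have "a powi e * d powi k * ((a\<^sup>2 * d) powi m * (inverse (a\<^sup>2) * d) powi l) =
      (a powi e * a powi (2 * m - 2 * l)) * (d powi k * (d powi m * d powi l))"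
    unfolding split_powi_factors[OF assms(1)] by (simp only: mult_ac)
  ultimately show ?thesis by (simp only:)
qed

text \<open>For the state given by the symmetric difference, the left side counts B-splittings minus
  A-splittings, which is the exponent of \<open>a\<close> in the bracket. The last parenthesis on
  the right will be \<open>twice_s\<close>.\<close>

lemma card_sym_diff_complement:
  assumes "finite C" "F \<subseteq> C" "W \<subseteq> C"
  shows "int (card (C - sym_diff F W)) - int (card (sym_diff F W)) =
    int (card C) - 2 * int (card F) + 2 * (int (card (F \<inter> W)) - int (card (W - F)))"
proof -
  have fin: "finite F" "finite W" using assms finite_subset by blast+
  have "card (sym_diff F W) = card (F - W) + card (W - F)"
    using fin by (intro card_Un_disjoint) auto
  moreover have "card F = card (F \<inter> W) + card (F - W)"
    using card_Int_Diff[OF fin(1)] .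
  moreover have "card (C - sym_diff F W) + card (sym_diff F W) = card C"
  proof -
    have "sym_diff F W \<subseteq> C" using assms by blast
    then show ?thesis
      using card_Diff_subset[of "sym_diff F W" C] card_mono[OF assms(1), of "sym_diff F W"] fin
        by simp
  qed
  ultimately have "int (card (sym_diff F W)) = int (card (F - W)) + int (card (W - F))"
    "int (card F) = int (card (F \<inter> W)) + int (card (F - W))"
    "int (card (C - sym_diff F W)) + int (card (sym_diff F W)) = int (card C)"
    by (metis of_nat_add)+
  then show ?thesis by simp
qed

lemma (in link_diagram) kauffman_bracket_switch:
  fixes a d :: "'a::field"
  assumes "a \<noteq> 0" "W \<subseteq> classical D"
  shows "kauffman_bracket D (inverse a) a d =
    (\<Sum>F\<in>Pow (classical D).
      a powi (int (card (classical D)) - 2 * int (card F) + 2 * (int (card (F \<inter> W)) - int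
        (card (W - F)))) *
      d powi (int (card (state_curves (switch W D) F)) - 1))"
  unfolding kauffman_bracket_def
proof (rule sum.reindex_bij_witness[where i = "\<lambda>F. sym_diff F W" and j = "\<lambda>F. sym_diff F W"])
  fix S assume S: "S \<in> Pow (classical D)"
  show inv: "sym_diff (sym_diff S W) W = S" by blast
  show "sym_diff S W \<in> Pow (classical D)" using S assms(2) by blast
  have "inverse a ^ card S * a ^ card (classical D - S) =
      a powi (int (card (classical D - S)) - int (card S))"
    using assms(1) by (simp add: power_int_diff power_inverse field_simps)
  also have "int (card (classical D - S)) - int (card S) =
      int (card (classical D)) - 2 * int (card (sym_diff S W)) +
      2 * (int (card (sym_diff S W \<inter> W)) - int (card (W - sym_diff S W)))"
    using card_sym_diff_complement[OF finite_classical, of "sym_diff S W" W] S assms(2)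
      unfolding inv by blast
  finally show "a powi (int (card (classical D)) - 2 * int (card (sym_diff S W)) +
        2 * (int (card (sym_diff S W \<inter> W)) - int (card (W - sym_diff S W)))) *
      d powi (int (card (state_curves (switch W D) (sym_diff S W))) - 1) =
    inverse a ^ card S * a ^ card (classical D - S) * d powi (int (card (state_curves D S)) - 1)"
    unfolding state_curves_switch inv by simp
next
  fix F assume "F \<in> Pow (classical D)"
  then show "sym_diff (sym_diff F W) W = F" "sym_diff F W \<in> Pow (classical D)"
    using assms(2) by blast+
qed

section \<open>State sums for the two graph polynomials\<close>

context alternating_link_diagram
begin

lemma twice_s_signs:
  assumes "F \<subseteq> classical D" "W \<subseteq> classical D" "eps = (\<lambda>z. if z \<in> W then -1 else 1)"
  shows "twice_s G F = int (card (F \<inter> W)) - int (card (W - F))"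
proof -
  have "{e \<in> F. eps e = -1} = F \<inter> W" "{e \<in> classical D - F. eps e = -1} = W - F"
    using assms by auto
  then show ?thesis by (simp add: twice_s_def num_neg_def)
qed

lemma core_graph_rank:
  "graph_rank (core_graph G) = graph_rank G"
  "graph_rank (spanning_subgraph (core_graph G) F) = graph_rank (sub F)"
  "graph_nullity (spanning_subgraph (core_graph G) F) = graph_nullity (sub F)"
  "edges (core_graph G) = classical D"
  by (simp_all add: graph_rank_def graph_nullity_def num_verts_def num_edges_def num_comps_def
      connected_rel_def core_graph_def multigraph.truncate_def spanning_subgraph_def sub_ends_def)

lemma rank_nullity_sub:
  "graph_rank (sub F) = num_verts G - num_comps (sub F)"
  "graph_nullity (sub F) = int (card F) - num_verts G + num_comps (sub F)"
  "graph_rank G = num_verts G - num_comps G"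
  "graph_nullity G = int (card (classical D)) - num_verts G + num_comps G"
  by (simp_all add: graph_rank_def graph_nullity_def num_verts_edges_sub num_edges_def)

text \<open>Rank plus nullity is the number of edges, for \<open>G\<close> and for each subgraph, so
  the exponent of \<open>a\<close> becomes \<open>e(G) - 2 e(F)\<close> plus the sign contribution.
  Rank plus components is the common number of vertices, so the exponent of \<open>d\<close> becomes
  \<open>bc(F) - 1\<close>.\<close>

lemma BR_poly_state_sum:
  fixes a d :: "'b::field"
  assumes "a \<noteq> 0" "d \<noteq> 0"
  shows "a powi (graph_nullity G - graph_rank G) * d powi (num_comps G - 1) *
      BR_poly G (a\<^sup>2) (a\<^sup>2 * d) (inverse (a\<^sup>2) * d) (1 / d) =
    (\<Sum>F\<in>Pow (classical D). a powi (int (card (classical D)) - 2 * int (card F) + 2 * twice_s G F) *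
      d powi (int (card (state_curves D F)) - 1))"
  unfolding BR_poly_def Let_def sum_distrib_left G_simps(2) BR_term[OF assms]
  by (rule sum.cong[OF refl]) (simp add: rank_nullity_sub num_bdry_sub algebra_simps)

text \<open>The Tutte polynomial has no variable recording the boundary; planarity replaces it by
  giving \<open>bc(F) = k(F) + n(F)\<close> for every subgraph.\<close>

lemma tutte_poly_state_sum:
  fixes a d :: "'b::field"
  assumes "a \<noteq> 0" "planar G" and xy: "x - 1 = a\<^sup>2 * d" "y - 1 = inverse (a\<^sup>2) * d"
  shows "a powi (graph_nullity G - graph_rank G) * d powi (num_comps G - 1) *
    tutte_poly (core_graph G) x y =
    (\<Sum>F\<in>Pow (classical D). a powi (int (card (classical D)) - 2 * int (card F)) *
      d powi (int (card (state_curves D F)) - 1))"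
  unfolding tutte_poly_def xy sum_distrib_left core_graph_rank
proof (rule sum.cong[OF refl])
  fix F assume "F \<in> Pow (classical D)"
  then have F: "F \<subseteq> classical D" by blast
  have "0 \<le> num_comps G" by (simp add: num_comps_def)
  moreover have "num_comps (sub F) = 0 \<and> num_verts G = 0 \<and> card F = 0" if "num_comps G = 0"
    using no_comps_imp_no_crossings[OF that] F
    by (simp add: num_comps_def num_verts_def)
  \<comment> \<open>Without vertices the only subgraph has exponents 0, so the negative power of
    \<open>d\<close> is never merged with another one.\<close>
  ultimately have k: "0 \<le> num_comps G - 1 \<or>
      graph_rank G - graph_rank (sub F) = 0 \<and> graph_nullity (sub F) = 0"
    unfolding rank_nullity_sub by linarith
  have m: "0 \<le> graph_rank G - graph_rank (sub F)"
    using num_comps_sub_ge[OF F] by (simp add: rank_nullity_sub)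
  have bc: "int (card (state_curves D F)) = num_comps (sub F) + graph_nullity (sub F)"
    using planar_num_bdry_sub[OF F assms(2)] by (simp add: num_bdry_sub)
  show "a powi (graph_nullity G - graph_rank G) * d powi (num_comps G - 1) *
      ((a\<^sup>2 * d) powi (graph_rank G - graph_rank (sub F)) *
        (inverse (a\<^sup>2) * d) powi graph_nullity (sub F)) =
    a powi (int (card (classical D)) - 2 * int (card F)) * d powi (int (card (state_curves D F)) -
      1)"
    unfolding tutte_term[OF assms(1) m nullity_sub_nonneg[OF F] k] bc
    by (simp add: rank_nullity_sub algebra_simps)
qed

end

theorem corollary4p2:
  fixes D :: "'i diagram" and G :: "'i link_ribbon_graph" and a t d :: "'a::field"
  assumes "virtual_link_diagram D"
    and "checkerboard_colorable D"
    and "corresponding_ribbon_graph D G"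
    and "a \<noteq> 0" and "t = a ^ 4" and "d = - (a^2) - inverse (a^2)"
  shows "(t \<noteq> -1 \<longrightarrow>
           jones D a =
             (-1) powi writhe D * a powi (3 * writhe D - graph_rank G + graph_nullity G) *
             d powi (num_comps G - 1) *
             BR_poly G (a^2) (- t - 1) (- inverse t - 1) (1 / d)) \<and>
         (planar G \<and> (\<forall>e\<in>edges G. edge_sign G e = 1) \<longrightarrow>
           jones D a =
             (-1) powi writhe D * a powi (3 * writhe D - graph_rank G + graph_nullity G) *
             d powi (num_comps G - 1) *
             tutte_poly (core_graph G) (- t) (- inverse t))"
proof -
  obtain W where W: "W \<subseteq> classical D" "alternating (switch W D)"
    and G: "G = alternating_ribbon_graph (switch W D) (\<lambda>z. if z \<in> W then -1 else 1)"
    using assms(3) unfolding corresponding_ribbon_graph_def by blast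
  interpret L: link_diagram D by unfold_locales (rule assms(1))
  interpret A: alternating_link_diagram "switch W D" "\<lambda>z. if z \<in> W then -1 else 1"
    by unfold_locales (rule L.virtual_link_diagram_switch, rule W(2))
  note s = A.twice_s_signs[unfolded switch_simps, OF _ W(1) refl, folded G]
  have x: "- t - 1 = a\<^sup>2 * d" and y: "- inverse t - 1 = inverse (a\<^sup>2) * d"
  proof -
    define b where "b = a\<^sup>2"
    have "t = b * b" "b \<noteq> 0" "d = - b - inverse b"
      using assms(4-6) by (simp_all add: b_def flip: power_add)
    then show "- t - 1 = a\<^sup>2 * d" "- inverse t - 1 = inverse (a\<^sup>2) * d"
      unfolding b_def[symmetric] by (simp_all add: right_diff_distrib)
  qed
  \<comment> \<open>The bracket of the given diagram, reindexed by spanning subgraphs; both formulas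
    reduce to this sum.\<close>
  define Z where "Z = (\<Sum>F\<in>Pow (classical D). a powi (int (card (classical D)) - 2 * int (card F) +
      2 * twice_s G F) * d powi (int (card (state_curves (switch W D) F)) - 1))"
  have J: "jones D a = (-1) powi writhe D * a powi (3 * writhe D) * Z"
    unfolding jones_def assms(6)[symmetric] L.kauffman_bracket_switch[OF assms(4) W(1)] Z_def
    by (simp add: s)
  have e: "a powi (3 * writhe D - graph_rank G + graph_nullity G) =
      a powi (3 * writhe D) * a powi (graph_nullity G - graph_rank G)"
    using assms(4) by (simp flip: power_int_add add: algebra_simps)
  show ?thesis
  proof (intro conjI impI)
    assume "t \<noteq> -1"
    then have "d \<noteq> 0" using x by (metis add.inverse_inverse eq_iff_diff_eq_0 mult_zero_right)
    then have "a powi (graph_nullity G - graph_rank G) * d powi (num_comps G - 1) *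
        BR_poly G (a\<^sup>2) (- t - 1) (- inverse t - 1) (1 / d) = Z"
      unfolding x y Z_def
      using A.BR_poly_state_sum[OF assms(4), unfolded switch_simps, folded G] by blast
    then show "jones D a = (-1) powi writhe D * a powi (3 * writhe D - graph_rank G +
      graph_nullity G) *
        d powi (num_comps G - 1) * BR_poly G (a^2) (- t - 1) (- inverse t - 1) (1 / d)"
      unfolding J e by (simp add: mult.assoc)
  next
    assume *: "planar G \<and> (\<forall>e\<in>edges G. edge_sign G e = 1)"
    \<comment> \<open>Edge signs are integers, so 1 and -1 differ whatever the characteristic of the
      field.\<close>
    have "z \<notin> W" if "z \<in> classical D" for z
      using * that unfolding G A.G_simps switch_simps by (auto split: if_splits)
    then have "W = {}" using W(1) by blast
    then have "twice_s G F = 0" if "F \<in> Pow (classical D)" for F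
      using s[of F] that by simp
    then have "Z = (\<Sum>F\<in>Pow (classical D). a powi (int (card (classical D)) - 2 * int (card F)) *
        d powi (int (card (state_curves (switch W D) F)) - 1))"
      unfolding Z_def by (intro sum.cong) simp_all
    then have "a powi (graph_nullity G - graph_rank G) * d powi (num_comps G - 1) *
        tutte_poly (core_graph G) (- t) (- inverse t) = Z"
      using A.tutte_poly_state_sum[OF assms(4), unfolded switch_simps, folded G, OF conjunct1[OF *]
        x y] by simp
    then show "jones D a = (-1) powi writhe D * a powi (3 * writhe D - graph_rank G +
      graph_nullity G) *
        d powi (num_comps G - 1) * tutte_poly (core_graph G) (- t) (- inverse t)"
      unfolding J e by (simp add: mult.assoc)
  qed
qed

end
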